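(* Let $u$ be an inner function on the open unit disk. (i) If $u(0)=0$, then $D_u$ is unitarily equivalent to the operator $\begin{bmatrix} S & 0\\ 0 & Q\end{bmatrix}: H^2\oplus\overline{H^2_0}\to H^2\oplus\overline{H^2_0}$, and thus for any two inner functions $u$ and $v$ which vanish at $0$, the operators $D_u$ and $D_v$ are unitarily equivalent. (ii) If $u(0)\neq 0$, then $D_u$ is unitarily equivalent to the operator $\begin{bmatrix} S & \overline{u(0)}\,(1\otimes \overline{z})\\ 0 & Q\end{bmatrix}: H^2\oplus\overline{H^2_0}\to H^2\oplus\overline{H^2_0}$.
   Context: $L^2=L^2(\mathbb{T},dm)$, where $\mathbb{T}$ is the unit circle and $m$ is normalized Lebesgue measure. $H^2=\{f\in L^2:\widehat f(n)=0\ \forall n<0\}$ is the Hardy space and $\overline{H^2_0}=\{\overline{zf}:f\in H^2\}$, so $L^2=H^2\oplus\overline{H^2_0}$; $P^{-}$ is the orthogonal projection of $L^2$ onto $\overline{H^2_0}$. For an inner function $u$, $\mathcal{K}_u=H^2\cap(uH^2)^{\perp}$, $P_u$ is the orthogonal projection of $L^2$ onto $\mathcal{K}_u$, and $\mathcal{K}_u^{\perp}$ is the orthogonal complement of $\mathcal{K}_u$ in $L^2$. The dual of the compressed shift is $D_u:\mathcal{K}_u^{\perp}\to\mathcal{K}_u^{\perp}$, $D_uf=(I-P_u)(zf)$. $S$ is the shift $(Sf)(z)=zf(z)$ on $H^2$; $Q:\overline{H^2_0}\to\overline{H^2_0}$ is $Qg=P^{-}(zg)$; and $1\otimes\overline{z}:\overline{H^2_0}\to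 H^2$ is the rank one operator $(1\otimes\overline z)g=\langle g,\overline z\rangle\,1$ with $\langle\cdot,\cdot\rangle$ the $L^2$ inner product. *)

theory Defs
  imports "HOL-Probability.Probability_Measure"
begin

class complex_inner = ab_group_add +
  fixes scaleC :: "complex \<Rightarrow> 'a \<Rightarrow> 'a" (infixr \<open>*\<^sub>C\<close> 75)
    and cinner :: "'a \<Rightarrow> 'a \<Rightarrow> complex"
  assumes scaleC_add_right: "a *\<^sub>C (x + y) = a *\<^sub>C x + a *\<^sub>C y"
    and scaleC_add_left: "(a + b) *\<^sub>C x = a *\<^sub>C x + b *\<^sub>C x"
    and scaleC_scaleC: "a *\<^sub>C b *\<^sub>C x = (a * b) *\<^sub>C x"
    and scaleC_one: "1 *\<^sub>C x = x"
    and cinner_commute: "cinner x y = cnj (cinner y x)"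
    and cinner_add_left: "cinner (x + y) z = cinner x z + cinner y z"
    and cinner_scaleC_left: "cinner (a *\<^sub>C x) y = a * cinner x y"
    and cinner_ge_zero: "0 \<le> Re (cinner x x)"
    and cinner_eq_zero_iff: "cinner x x = 0 \<longleftrightarrow> x = 0"

text \<open>The product type with this structure is the (external) Hilbert space direct sum.\<close>

instantiation prod :: (complex_inner, complex_inner) complex_inner
begin

definition scaleC_prod :: "complex \<Rightarrow> 'a \<times> 'b \<Rightarrow> 'a \<times> 'b" where
  "scaleC_prod a p = (a *\<^sub>C fst p, a *\<^sub>C snd p)"

definition cinner_prod :: "'a \<times> 'b \<Rightarrow> 'a \<times> 'b \<Rightarrow> complex" where
  "cinner_prod p q = cinner (fst p) (fst q) + cinner (snd p) (snd q)"

instance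
proof
  fix a b :: complex and x y z :: "'a \<times> 'b"
  show "a *\<^sub>C (x + y) = a *\<^sub>C x + a *\<^sub>C y" "(a + b) *\<^sub>C x = a *\<^sub>C x + b *\<^sub>C x"
    "a *\<^sub>C b *\<^sub>C x = (a * b) *\<^sub>C x" "1 *\<^sub>C x = x"
    by (simp_all add: scaleC_prod_def scaleC_add_right scaleC_add_left scaleC_scaleC scaleC_one
        prod_eq_iff)
  show "cinner x y = cnj (cinner y x)"
    unfolding cinner_prod_def complex_cnj_add by (metis cinner_commute)
  show "cinner (x + y) z = cinner x z + cinner y z" "cinner (a *\<^sub>C x) y = a * cinner x y"
    by (simp_all add: cinner_prod_def scaleC_prod_def cinner_add_left cinner_scaleC_left
        algebra_simps)
  show "0 \<le> Re (cinner x x)"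
    by (simp add: cinner_prod_def cinner_ge_zero)
  have im: "Im (cinner w w) = 0" for w :: "'c::complex_inner"
    using cinner_commute[of w w] by (simp add: complex_eq_iff)
  have re0: "Re (cinner w w) = 0 \<longleftrightarrow> w = 0" for w :: "'c::complex_inner"
    using cinner_eq_zero_iff[of w] im[of w] by (simp add: complex_eq_iff)
  have "cinner x x = 0 \<longleftrightarrow> Re (cinner (fst x) (fst x)) + Re (cinner (snd x) (snd x)) = 0"
    by (simp add: cinner_prod_def complex_eq_iff im)
  also have "\<dots> \<longleftrightarrow> fst x = 0 \<and> snd x = 0"
    by (simp add: add_nonneg_eq_0_iff cinner_ge_zero re0)
  finally show "cinner x x = 0 \<longleftrightarrow> x = 0"
    by (simp add: prod_eq_iff)
qed

end

definition orth_compl :: "'a::complex_inner set \<Rightarrow> 'a set" where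
  "orth_compl M = {x. \<forall>y\<in>M. cinner x y = 0}"

text \<open>Meaningful when \<^term>\<open>M\<close> is a closed subspace of a Hilbert space.\<close>

definition orth_proj :: "'a::complex_inner set \<Rightarrow> 'a \<Rightarrow> 'a" where
  "orth_proj M x = (THE y. y \<in> M \<and> x - y \<in> orth_compl M)"

definition rank_one :: "'b::complex_inner \<Rightarrow> 'a::complex_inner \<Rightarrow> 'a \<Rightarrow> 'b" where
  "rank_one a b g = cinner g b *\<^sub>C a"

text \<open>The operator matrix with rows \<open>A B\<close> and \<open>C D\<close>.\<close>

definition block_op ::
  "('a \<Rightarrow> 'c::plus) \<Rightarrow> ('b \<Rightarrow> 'c) \<Rightarrow> ('a \<Rightarrow> 'd::plus) \<Rightarrow> ('b \<Rightarrow> 'd) \<Rightarrow> 'a \<times> 'b \<Rightarrow> 'c \<times> 'd" where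
  "block_op A B C D = (\<lambda>(f, g). (A f + B g, C f + D g))"

text \<open>Spaces are given by carrier sets (subspaces of an ambient type), and operators by functions
  on the ambient type of which only the values on the carrier matter.\<close>

definition unitary_between ::
  "'a::complex_inner set \<Rightarrow> 'b::complex_inner set \<Rightarrow> ('a \<Rightarrow> 'b) \<Rightarrow> bool" where
  "unitary_between M N U \<longleftrightarrow>
     bij_betw U M N \<and>
     (\<forall>x\<in>M. \<forall>y\<in>M. U (x + y) = U x + U y) \<and>
     (\<forall>a. \<forall>x\<in>M. U (a *\<^sub>C x) = a *\<^sub>C U x) \<and>
     (\<forall>x\<in>M. \<forall>y\<in>M. cinner (U x) (U y) = cinner x y)"

definition unitarily_equivalent ::
  "'a::complex_inner set \<Rightarrow> ('a \<Rightarrow> 'a) \<Rightarrow> 'b::complex_inner set \<Rightarrow> ('b \<Rightarrow> 'b) \<Rightarrow> bool" where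
  "unitarily_equivalent M A N B \<longleftrightarrow>
     A ` M \<subseteq> M \<and> B ` N \<subseteq> N \<and>
     (\<exists>U. unitary_between M N U \<and> (\<forall>x\<in>M. U (A x) = B (U x)))"


text \<open>Normalized Lebesgue measure on the Borel sets of the unit circle. Passing to the completed
  sigma-algebra would not change the space of almost-everywhere classes below.\<close>

definition circle_measure :: "complex measure" where
  "circle_measure =
     distr (uniform_measure lborel {0..<2 * pi}) (restrict_space borel (sphere 0 1)) cis"

definition square_integrable :: "(complex \<Rightarrow> complex) \<Rightarrow> bool" where
  "square_integrable f \<longleftrightarrow>
     f \<in> borel_measurable circle_measure \<and> integrable circle_measure (\<lambda>z. (cmod (f z))\<^sup>2)"

definition L2_rel :: "(complex \<Rightarrow> complex) \<Rightarrow> (complex \<Rightarrow> complex) \<Rightarrow> bool" where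
  "L2_rel f g \<longleftrightarrow>
     square_integrable f \<and> square_integrable g \<and> (AE z in circle_measure. f z = g z)"

lemma space_circle_measure [simp]: "space circle_measure = sphere 0 1"
  by (simp add: circle_measure_def space_restrict_space)

lemma prob_space_circle_measure: "prob_space circle_measure"
  unfolding circle_measure_def
proof (rule prob_space.prob_space_distr)
  show "prob_space (uniform_measure lborel {0..<2 * pi})"
    by (rule prob_space_uniform_measure) auto
  have "cis \<in> measurable borel (restrict_space borel (sphere 0 1))"
    by (rule measurable_restrict_space2)
      (auto intro!: borel_measurable_continuous_onI continuous_intros)
  then show "cis \<in> measurable (uniform_measure lborel {0..<2 * pi})
      (restrict_space borel (sphere 0 1))"
    by (simp cong: measurable_cong_sets)
qed


lemma square_integrableD [measurable_dest]:
  "square_integrable f \<Longrightarrow> f \<in> borel_measurable circle_measure"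
  by (simp add: square_integrable_def)

lemma square_integrable_bounded_mult:
  assumes "square_integrable f" and [measurable]: "\<phi> \<in> borel_measurable circle_measure"
    and "\<And>z. cmod z = 1 \<Longrightarrow> cmod (\<phi> z) \<le> B"
  shows "square_integrable (\<lambda>z. \<phi> z * f z)"
  unfolding square_integrable_def
proof
  have [measurable]: "f \<in> borel_measurable circle_measure"
    using assms(1) by measurable
  show "(\<lambda>z. \<phi> z * f z) \<in> borel_measurable circle_measure"
    by measurable
  have "integrable circle_measure (\<lambda>z. B\<^sup>2 * (cmod (f z))\<^sup>2)"
    using assms(1) by (auto simp: square_integrable_def)
  then show "integrable circle_measure (\<lambda>z. (cmod (\<phi> z * f z))\<^sup>2)"
  proof (rule Bochner_Integration.integrable_bound)
    have "(cmod (\<phi> z * f z))\<^sup>2 \<le> B\<^sup>2 * (cmod (f z))\<^sup>2" if "cmod z = 1" for z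
      using assms(3)[OF that] by (auto simp: norm_mult power_mult_distrib intro!: mult_right_mono power_mono)
    then show "AE z in circle_measure.
        norm ((cmod (\<phi> z * f z))\<^sup>2) \<le> norm (B\<^sup>2 * (cmod (f z))\<^sup>2)"
      by (intro AE_I2) simp
  qed measurable
qed

lemma square_integrable_add:
  assumes "square_integrable f" "square_integrable g"
  shows "square_integrable (\<lambda>z. f z + g z)"
  unfolding square_integrable_def
proof
  have [measurable]: "f \<in> borel_measurable circle_measure" "g \<in> borel_measurable circle_measure"
    using assms by measurable
  show "(\<lambda>z. f z + g z) \<in> borel_measurable circle_measure"
    by measurable
  have "integrable circle_measure (\<lambda>z. 2 * (cmod (f z))\<^sup>2 + 2 * (cmod (g z))\<^sup>2)"
    using assms by (auto simp: square_integrable_def)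
  then show "integrable circle_measure (\<lambda>z. (cmod (f z + g z))\<^sup>2)"
  proof (rule Bochner_Integration.integrable_bound)
    have "(cmod (f z + g z))\<^sup>2 \<le> 2 * (cmod (f z))\<^sup>2 + 2 * (cmod (g z))\<^sup>2" for z
    proof -
      have "(cmod (f z + g z))\<^sup>2 \<le> (cmod (f z) + cmod (g z))\<^sup>2"
        by (intro power_mono norm_triangle_ineq) simp
      also have "\<dots> \<le> 2 * (cmod (f z))\<^sup>2 + 2 * (cmod (g z))\<^sup>2"
        using sum_squares_bound[of "cmod (f z)" "cmod (g z)"] by (simp add: power2_sum)
      finally show ?thesis .
    qed
    then show "AE z in circle_measure.
        norm ((cmod (f z + g z))\<^sup>2) \<le> norm (2 * (cmod (f z))\<^sup>2 + 2 * (cmod (g z))\<^sup>2)"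
      by (intro AE_I2) simp
  qed measurable
qed

lemma square_integrable_const: "square_integrable (\<lambda>_. c)"
proof -
  interpret prob_space circle_measure by (rule prob_space_circle_measure)
  show ?thesis by (simp add: square_integrable_def)
qed

lemma square_integrable_scale:
  assumes "square_integrable f"
  shows "square_integrable (\<lambda>z. c * f z)"
  by (rule square_integrable_bounded_mult[OF assms, of "\<lambda>_. c" "cmod c"]) auto

lemma borel_measurable_circle_continuous:
  "continuous_on UNIV \<phi> \<Longrightarrow> (\<phi> :: complex \<Rightarrow> complex) \<in> borel_measurable circle_measure"
  unfolding circle_measure_def
  by (simp add: borel_measurable_continuous_onI measurable_restrict_space1)

lemma square_integrable_id_mult:
  assumes "square_integrable f"
  shows "square_integrable (\<lambda>z. z * f z)"
  by (rule square_integrable_bounded_mult[OF assms, of "\<lambda>z. z" 1])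
    (auto intro: borel_measurable_circle_continuous)

lemma square_integrable_cnj:
  assumes "square_integrable f"
  shows "square_integrable (\<lambda>z. cnj (f z))"
proof -
  have [measurable]: "cnj \<in> borel_measurable borel"
    by (intro borel_measurable_continuous_onI continuous_intros)
  have [measurable]: "f \<in> borel_measurable circle_measure"
    using assms by measurable
  show ?thesis
    using assms by (simp add: square_integrable_def)
qed

lemma square_integrable_cinner:
  assumes "square_integrable f" "square_integrable g"
  shows "integrable circle_measure (\<lambda>z. f z * cnj (g z))"
proof -
  have [measurable]: "f \<in> borel_measurable circle_measure"
      "(\<lambda>z. cnj (g z)) \<in> borel_measurable circle_measure"
    using assms(1) square_integrable_cnj[OF assms(2)] by (auto dest: square_integrableD)
  have "integrable circle_measure (\<lambda>z. (cmod (f z))\<^sup>2 + (cmod (g z))\<^sup>2)"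
    using assms by (auto simp: square_integrable_def)
  then show ?thesis
  proof (rule Bochner_Integration.integrable_bound)
    have "cmod (f z * cnj (g z)) \<le> (cmod (f z))\<^sup>2 + (cmod (g z))\<^sup>2" for z
    proof -
      have "0 \<le> cmod (f z) * cmod (g z)" by simp
      then show ?thesis
        using sum_squares_bound[of "cmod (f z)" "cmod (g z)"]
        unfolding norm_mult complex_mod_cnj mult.assoc by linarith
    qed
    then show "AE z in circle_measure.
        norm (f z * cnj (g z)) \<le> norm ((cmod (f z))\<^sup>2 + (cmod (g z))\<^sup>2)"
      by (intro AE_I2) simp
  qed measurable
qed

quotient_type L2 = "complex \<Rightarrow> complex" / partial: L2_rel
proof (rule part_equivpI)
  show "\<exists>f. L2_rel f f"
    using square_integrable_const by (auto simp: L2_rel_def)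
  show "symp L2_rel"
    by (auto simp: symp_def L2_rel_def)
  show "transp L2_rel"
    unfolding transp_def L2_rel_def by (auto elim: AE_mp)
qed

instantiation L2 :: complex_inner
begin

lift_definition zero_L2 :: L2 is "\<lambda>_. 0"
  by (simp add: L2_rel_def square_integrable_const)

lift_definition plus_L2 :: "L2 \<Rightarrow> L2 \<Rightarrow> L2" is "\<lambda>f g z. f z + g z"
  unfolding L2_rel_def by (auto simp: square_integrable_add)

lift_definition scaleC_L2 :: "complex \<Rightarrow> L2 \<Rightarrow> L2" is "\<lambda>a f z. a * f z"
  unfolding L2_rel_def by (auto simp: square_integrable_scale)

definition uminus_L2 :: "L2 \<Rightarrow> L2" where "uminus_L2 f = (- 1) *\<^sub>C f"

definition minus_L2 :: "L2 \<Rightarrow> L2 \<Rightarrow> L2" where "minus_L2 f g = f + - g"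

lift_definition cinner_L2 :: "L2 \<Rightarrow> L2 \<Rightarrow> complex"
  is "\<lambda>f g. LINT z|circle_measure. f z * cnj (g z)"
  unfolding L2_rel_def
  by (rule integral_cong_AE)
    (auto intro!: borel_measurable_times dest: square_integrableD square_integrable_cnj)

instance
proof
  fix a b :: complex and x y z :: L2
  show "x + y + z = x + (y + z)" "x + y = y + x" "0 + x = x"
    by (transfer; auto simp: L2_rel_def square_integrable_add square_integrable_const add_ac)+
  show "- x + x = 0"
    unfolding uminus_L2_def
    by transfer (auto simp: L2_rel_def square_integrable_add square_integrable_scale
        square_integrable_const)
  show "x - y = x + - y"
    by (fact minus_L2_def)
  show "a *\<^sub>C (x + y) = a *\<^sub>C x + a *\<^sub>C y" "(a + b) *\<^sub>C x = a *\<^sub>C x + b *\<^sub>C x"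
    "a *\<^sub>C b *\<^sub>C x = (a * b) *\<^sub>C x" "1 *\<^sub>C x = x"
    by (transfer; auto simp: L2_rel_def square_integrable_add square_integrable_scale algebra_simps)+
  show "cinner x y = cnj (cinner y x)"
  proof transfer
    fix f g :: "complex \<Rightarrow> complex"
    have "cnj (LINT z|circle_measure. g z * cnj (f z)) =
        (LINT z|circle_measure. cnj (g z * cnj (f z)))"
      by (rule Bochner_Integration.integral_cnj[symmetric])
    then show "(LINT z|circle_measure. f z * cnj (g z)) =
        cnj (LINT z|circle_measure. g z * cnj (f z))"
      by (simp add: mult.commute)
  qed
  show "cinner (x + y) z = cinner x z + cinner y z"
    by transfer (simp add: L2_rel_def algebra_simps square_integrable_cinner)
  show "cinner (a *\<^sub>C x) y = a * cinner x y"
    by transfer (simp add: mult.assoc)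
  have *: "(LINT z|circle_measure. f z * cnj (f z)) =
      complex_of_real (LINT z|circle_measure. (cmod (f z))\<^sup>2)" for f
    unfolding integral_complex_of_real[symmetric] complex_norm_square ..
  show "0 \<le> Re (cinner x x)"
    by transfer (simp add: *)
  show "cinner x x = 0 \<longleftrightarrow> x = 0"
  proof transfer
    fix f assume "L2_rel f f"
    then have f: "square_integrable f" by (simp add: L2_rel_def)
    have "(LINT z|circle_measure. (cmod (f z))\<^sup>2) = 0 \<longleftrightarrow>
        (AE z in circle_measure. (cmod (f z))\<^sup>2 = 0)"
      using f by (intro integral_nonneg_eq_0_iff_AE) (auto simp: square_integrable_def)
    then show "(LINT z|circle_measure. f z * cnj (f z)) = 0 \<longleftrightarrow> L2_rel f (\<lambda>_. 0)"
      unfolding * L2_rel_def using f by (simp add: square_integrable_const)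
  qed
qed

end

lift_definition mult_z :: "L2 \<Rightarrow> L2" is "\<lambda>f z. z * f z"
  unfolding L2_rel_def by (auto simp: square_integrable_id_mult)

lift_definition cnj_L2 :: "L2 \<Rightarrow> L2" is "\<lambda>f z. cnj (f z)"
  unfolding L2_rel_def by (auto simp: square_integrable_cnj)

lift_definition one_L2 :: L2 is "\<lambda>_. 1"
  by (simp add: L2_rel_def square_integrable_const)

lift_definition zbar_L2 :: L2 is "\<lambda>z. cnj z"
  using square_integrable_cnj[OF square_integrable_id_mult[OF square_integrable_const[of 1]]]
  by (simp add: L2_rel_def)

lift_definition fourier_coeff :: "L2 \<Rightarrow> int \<Rightarrow> complex"
  is "\<lambda>f n. LINT z|circle_measure. f z * z powi (- n)"
proof (rule ext)
  fix f g :: "complex \<Rightarrow> complex" and n :: int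
  assume fg: "L2_rel f g"
  then have [measurable]: "f \<in> borel_measurable circle_measure" "g \<in> borel_measurable circle_measure"
    by (auto simp: L2_rel_def dest: square_integrableD)
  have [measurable]: "(\<lambda>z::complex. z) \<in> borel_measurable circle_measure"
    by (rule borel_measurable_circle_continuous) simp
  show "(LINT z|circle_measure. f z * z powi (- n)) = (LINT z|circle_measure. g z * z powi (- n))"
  proof (rule integral_cong_AE)
    show "(\<lambda>z. f z * z powi (- n)) \<in> borel_measurable circle_measure"
        "(\<lambda>z. g z * z powi (- n)) \<in> borel_measurable circle_measure"
      unfolding power_int_def by measurable
    show "AE z in circle_measure. f z * z powi (- n) = g z * z powi (- n)"
      using fg by (auto simp: L2_rel_def)
  qed
qed


definition H2 :: "L2 set" where
  "H2 = {f. \<forall>n<0. fourier_coeff f n = 0}"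

definition H2_0_bar :: "L2 set" where
  "H2_0_bar = {cnj_L2 (mult_z f) |f. f \<in> H2}"

definition radial_limit :: "(complex \<Rightarrow> complex) \<Rightarrow> complex \<Rightarrow> complex" where
  "radial_limit u \<zeta> = Lim (at_left 1) (\<lambda>r::real. u (of_real r * \<zeta>))"

text \<open>Only the values of \<open>u\<close> on the open unit disk matter. Almost-everywhere existence of the radial
  limits is automatic for bounded holomorphic functions (Fatou); it is stated because \<^const>\<open>Lim\<close>
  is meaningful only where the limit exists.\<close>

definition inner_function :: "(complex \<Rightarrow> complex) \<Rightarrow> bool" where
  "inner_function u \<longleftrightarrow>
     u holomorphic_on ball 0 1 \<and> bounded (u ` ball 0 1) \<and>
     (AE \<zeta> in circle_measure.
        ((\<lambda>r::real. u (of_real r * \<zeta>)) \<longlongrightarrow> radial_limit u \<zeta>) (at_left 1) \<and>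
        cmod (radial_limit u \<zeta>) = 1)"

text \<open>The subspace \<open>u H\<^sup>2\<close> of \<open>L\<^sup>2\<close>, where \<open>u\<close> acts through its boundary function. The choice of
  the representatives \<^term>\<open>rep_L2 f\<close> and \<^term>\<open>rep_L2 h\<close> does not matter.\<close>

definition mult_H2 :: "(complex \<Rightarrow> complex) \<Rightarrow> L2 set" where
  "mult_H2 u =
     {f. \<exists>h\<in>H2. AE \<zeta> in circle_measure. rep_L2 f \<zeta> = radial_limit u \<zeta> * rep_L2 h \<zeta>}"

definition model_space :: "(complex \<Rightarrow> complex) \<Rightarrow> L2 set" where
  "model_space u = H2 \<inter> orth_compl (mult_H2 u)"

definition dual_compressed_shift :: "(complex \<Rightarrow> complex) \<Rightarrow> L2 \<Rightarrow> L2" where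
  "dual_compressed_shift u f = mult_z f - orth_proj (model_space u) (mult_z f)"

definition shift :: "L2 \<Rightarrow> L2" where
  "shift f = mult_z f"

definition P_minus :: "L2 \<Rightarrow> L2" where
  "P_minus = orth_proj H2_0_bar"

definition Q_op :: "L2 \<Rightarrow> L2" where
  "Q_op g = P_minus (mult_z g)"

end

theory Submission
  imports Defs "HOL-Complex_Analysis.Complex_Analysis"
begin

text \<open>Let \<open>\<phi>\<close> be the boundary function of \<open>u\<close>. Since \<open>|\<phi>| = 1\<close> almost everywhere, the orthogonal
  complement of the model space is \<open>\<phi>H\<^sup>2\<close> plus the conjugate-analytic functions, and
  \<open>V (h, g) = \<phi>h + g\<close> is a unitary map onto it. For conjugate-analytic \<open>g\<close> one has
  \<open>zg = Qg + c\<close> with the constant \<open>c = \<langle>g, zbar\<rangle>\<close>, and the projection of \<open>1\<close> onto the model space is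
  the kernel function \<open>1 - cnj (u 0) \<phi>\<close>. Hence \<open>D\<^sub>u V (h, g) = V (zh + cnj (u 0) c, Qg)\<close>, which is
  the operator matrix of (ii); its off-diagonal entry vanishes if \<open>u 0 = 0\<close>.

  That every \<open>L\<^sup>2\<close> function splits into an analytic and a conjugate-analytic part, and that these are
  orthogonal, rests on the completeness of \<open>L\<^sup>2\<close> and on the totality of the powers of \<open>z\<close>
  (Stone-Weierstrass). The Fourier coefficients of \<open>\<phi>\<close> come from the mean value property on circles
  of radius \<open>r < 1\<close> by dominated convergence.\<close>

section \<open>Complex inner product spaces and unitary equivalence\<close>

lemma cinner_zero_left [simp]: "cinner 0 (y::'a::complex_inner) = 0"
  using cinner_add_left[of 0 0 y] by simp

lemma cinner_add_right: "cinner x (y + z) = cinner x y + cinner x (z::'a::complex_inner)"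
  by (metis cinner_add_left cinner_commute complex_cnj_add)

lemma cinner_zero_right [simp]: "cinner (x::'a::complex_inner) 0 = 0"
  using cinner_add_right[of x 0 0] by simp

lemma cinner_minus_left [simp]: "cinner (- x) y = - cinner x (y::'a::complex_inner)"
  using cinner_add_left[of x "- x" y] by (simp add: eq_neg_iff_add_eq_0 add.commute)

lemma cinner_minus_right [simp]: "cinner x (- y) = - cinner x (y::'a::complex_inner)"
  by (metis cinner_commute cinner_minus_left complex_cnj_minus)

lemma cinner_diff_left: "cinner (x - y) z = cinner x z - cinner y (z::'a::complex_inner)"
  using cinner_add_left[of x "- y" z] by simp

lemma cinner_diff_right: "cinner x (y - z) = cinner x y - cinner x (z::'a::complex_inner)"
  using cinner_add_right[of x y "- z"] by simp

lemma cinner_scaleC_right: "cinner x (a *\<^sub>C y) = cnj a * cinner x (y::'a::complex_inner)"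
  by (metis cinner_commute cinner_scaleC_left complex_cnj_mult)

lemma cinner_sum_left: "cinner (\<Sum>i\<in>A. f i) (y::'a::complex_inner) = (\<Sum>i\<in>A. cinner (f i) y)"
  by (induction A rule: infinite_finite_induct) (simp_all add: cinner_add_left)

lemma cinner_sum_right: "cinner (y::'a::complex_inner) (\<Sum>i\<in>A. f i) = (\<Sum>i\<in>A. cinner y (f i))"
  by (induction A rule: infinite_finite_induct) (simp_all add: cinner_add_right)

lemma scaleC_zero_left [simp]: "0 *\<^sub>C x = (0::'a::complex_inner)"
  using scaleC_add_left[of 0 0 x] by simp

lemma cinner_eq_0_commute: "cinner x y = 0 \<longleftrightarrow> cinner y (x::'a::complex_inner) = 0"
  by (metis cinner_commute complex_cnj_zero)

section \<open>Squared norms, Cauchy-Schwarz and uniqueness of projections\<close>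

definition sqnorm :: "'a::complex_inner \<Rightarrow> real" where
  "sqnorm x = Re (cinner x x)"

lemma sqnorm_nonneg [simp]: "0 \<le> sqnorm x"
  by (simp add: sqnorm_def cinner_ge_zero)

lemma cinner_self: "cinner x x = of_real (sqnorm x)"
  using cinner_commute[of x x] by (simp add: complex_eq_iff sqnorm_def)

lemma sqnorm_minus_commute: "sqnorm (x - y) = sqnorm (y - x)"
  by (simp add: sqnorm_def cinner_diff_left cinner_diff_right)

text \<open>The vector \<open>w = b x - c y\<close> is the component of \<open>x\<close> orthogonal
  to \<open>y\<close>, scaled by \<open>b = sqnorm y\<close> to avoid a division. Its squared norm
  is \<open>b * (b * sqnorm x - (cmod c)\<^sup>2)\<close>, from which \<open>b > 0\<close>
  cancels.\<close>

lemma Cauchy_Schwarz: "(cmod (cinner x y))\<^sup>2 \<le> sqnorm x * sqnorm y"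
proof (cases "y = 0")
  case False
  define c where "c = cinner x y"
  define b where "b = sqnorm y"
  have b: "b > 0"
    using False cinner_eq_zero_iff[of y] sqnorm_nonneg[of y] cinner_self[of y]
    unfolding b_def by (metis less_eq_real_def of_real_0)
  have yx: "cinner y x = cnj c"
    unfolding c_def by (rule cinner_commute)
  define w where "w = of_real b *\<^sub>C x - c *\<^sub>C y"
  have "cinner w w = of_real b * of_real b * cinner x x - of_real b * c * cnj c"
    unfolding w_def
    by (simp add: cinner_diff_left cinner_diff_right cinner_scaleC_left cinner_scaleC_right
        c_def[symmetric] yx cinner_self[of y] b_def[symmetric] algebra_simps)
  also have "\<dots> = of_real (b * (b * sqnorm x - (cmod c)\<^sup>2))"
    unfolding cinner_self of_real_mult of_real_diff complex_norm_square by (simp add: algebra_simps)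
  finally have "0 \<le> b * (b * sqnorm x - (cmod c)\<^sup>2)"
    by (metis Re_complex_of_real sqnorm_def sqnorm_nonneg)
  then show ?thesis
    using b by (simp add: zero_le_mult_iff c_def b_def mult.commute)
qed (simp add: sqnorm_def)

text \<open>Convergence is expressed by \<open>sqnorm\<close> of the difference because the class
  carries no topology; Cauchy-Schwarz turns it into convergence of scalars.\<close>

lemma tendsto_cinner_left:
  assumes "(\<lambda>n. sqnorm (X n - L)) \<longlonglongrightarrow> 0"
  shows "(\<lambda>n. cinner (X n) y) \<longlonglongrightarrow> cinner L y"
proof -
  have "(\<lambda>n. (cmod (cinner (X n - L) y))\<^sup>2) \<longlonglongrightarrow> 0"
  proof (rule tendsto_sandwich[OF _ _ tendsto_const])
    show "(\<lambda>n. sqnorm (X n - L) * sqnorm y) \<longlonglongrightarrow> 0"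
      using tendsto_mult_left_zero[OF assms] by simp
  qed (auto simp: Cauchy_Schwarz)
  then have "(\<lambda>n. cinner (X n - L) y) \<longlonglongrightarrow> 0"
    by (simp add: tendsto_norm_zero_iff)
  then show ?thesis
    by (simp add: cinner_diff_left LIM_zero_cancel)
qed

text \<open>Two candidates for the projection differ by an element of \<open>M\<close> that is
  orthogonal to itself. Exhibiting one candidate therefore computes the projection, which is how it
  is evaluated below.\<close>

lemma orth_proj_eqI:
  assumes M: "\<And>x y. x \<in> M \<Longrightarrow> y \<in> M \<Longrightarrow> x - y \<in> M"
    and y: "y \<in> M" "x - y \<in> orth_compl M"
  shows "orth_proj M x = y"
  unfolding orth_proj_def
proof (rule the_equality)
  fix y' assume y': "y' \<in> M \<and> x - y' \<in> orth_compl M"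
  then have m: "y' - y \<in> M" using M y by auto
  have "cinner (x - y) (y' - y) = 0" "cinner (x - y') (y' - y) = 0"
    using m y y' by (auto simp: orth_compl_def)
  then have "cinner ((x - y) - (x - y')) (y' - y) = 0"
    by (simp only: cinner_diff_left[of "x - y"]) simp
  then show "y' = y" by (simp add: cinner_eq_zero_iff)
qed (use y in auto)

section \<open>Inverses and compositions of unitary equivalences\<close>

lemma unitary_between_inv_into:
  assumes "unitary_between M N U"
    and add: "\<And>x y. x \<in> M \<Longrightarrow> y \<in> M \<Longrightarrow> x + y \<in> M"
    and scale: "\<And>a x. x \<in> M \<Longrightarrow> a *\<^sub>C x \<in> M"
  shows "unitary_between N M (inv_into M U)"
proof -
  have bij: "bij_betw U M N"
    and U: "\<And>x y. x \<in> M \<Longrightarrow> y \<in> M \<Longrightarrow> U (x + y) = U x + U y"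
      "\<And>a x. x \<in> M \<Longrightarrow> U (a *\<^sub>C x) = a *\<^sub>C U x"
      "\<And>x y. x \<in> M \<Longrightarrow> y \<in> M \<Longrightarrow> cinner (U x) (U y) = cinner x y"
    using assms(1) by (auto simp: unitary_between_def)
  let ?V = "inv_into M U"
  have V: "?V y \<in> M" "U (?V y) = y" if "y \<in> N" for y
    using that bij by (auto simp: bij_betw_def inv_into_into f_inv_into_f)
  have VU: "?V (U x) = x" if "x \<in> M" for x
    using that bij by (auto simp: bij_betw_def)
  show ?thesis
    unfolding unitary_between_def
  proof (intro conjI ballI allI)
    show "bij_betw ?V N M" by (rule bij_betw_inv_into[OF bij])
    fix x y a assume x: "x \<in> N"
    show "?V (a *\<^sub>C x) = a *\<^sub>C ?V x"
      using VU[OF scale[OF V(1)[OF x]], of a] V[OF x] by (simp add: U)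
    assume y: "y \<in> N"
    show "?V (x + y) = ?V x + ?V y"
      using VU[OF add[OF V(1)[OF x] V(1)[OF y]]] V[OF x] V[OF y] by (simp add: U)
    show "cinner (?V x) (?V y) = cinner x y"
      using U(3)[OF V(1)[OF x] V(1)[OF y]] V[OF x] V[OF y] by simp
  qed
qed

text \<open>The explicit unitary map constructed below starts from
  \<open>H2 \<times> H2_0_bar\<close>; symmetry reverses it. Closure of \<open>M\<close> under
  addition and scaling makes the inverse linear.\<close>

lemma unitarily_equivalent_sym:
  assumes "unitarily_equivalent M A N B"
    and "\<And>x y. x \<in> M \<Longrightarrow> y \<in> M \<Longrightarrow> x + y \<in> M"
    and "\<And>a x. x \<in> M \<Longrightarrow> a *\<^sub>C x \<in> M"
  shows "unitarily_equivalent N B M A"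
proof -
  obtain U where U: "unitary_between M N U" "\<forall>x\<in>M. U (A x) = B (U x)"
    and inv: "A ` M \<subseteq> M" "B ` N \<subseteq> N"
    using assms(1) by (auto simp: unitarily_equivalent_def)
  have bij: "bij_betw U M N" using U(1) by (simp add: unitary_between_def)
  have "inv_into M U (B y) = A (inv_into M U y)" if y: "y \<in> N" for y
  proof -
    obtain x where x: "x \<in> M" "y = U x"
      using y bij by (auto simp: bij_betw_def)
    have "A x \<in> M" using x inv by auto
    then show ?thesis
      using x bij U(2) by (metis bij_betw_def inv_into_f_f)
  qed
  then show ?thesis
    using unitary_between_inv_into[OF U(1) assms(2,3)] inv
    unfolding unitarily_equivalent_def by blast
qed

lemma unitarily_equivalent_trans:
  assumes "unitarily_equivalent M A N B" "unitarily_equivalent N B K C"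
  shows "unitarily_equivalent M A K C"
proof -
  obtain U V where U: "unitary_between M N U" "\<forall>x\<in>M. U (A x) = B (U x)"
    and V: "unitary_between N K V" "\<forall>x\<in>N. V (B x) = C (V x)"
    and inv: "A ` M \<subseteq> M" "C ` K \<subseteq> K"
    using assms by (auto simp: unitarily_equivalent_def)
  have bij: "bij_betw U M N" "bij_betw V N K"
    using U V by (auto simp: unitary_between_def)
  have UN: "U x \<in> N" if "x \<in> M" for x
    using that bij(1) by (auto simp: bij_betw_def)
  have "unitary_between M K (V \<circ> U)"
    using U(1) V(1) bij_betw_trans[OF bij] UN by (simp add: unitary_between_def)
  then show ?thesis
    using inv U(2) V(2) UN unfolding unitarily_equivalent_def
    by (intro conjI exI[of _ "V \<circ> U"]) auto
qed

section \<open>Integration over the unit circle and Fourier coefficients\<close>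

text \<open>The integral is transferred along \<open>cis\<close> to an interval, where continuity
  converts it to the Henstock-Kurzweil integral in which contour integrals are expressed.\<close>

lemma integral_circle_measure:
  fixes f :: "complex \<Rightarrow> complex"
  assumes "f \<in> borel_measurable circle_measure" "continuous_on {0..2 * pi} (\<lambda>t. f (cis t))"
  shows "(LINT z|circle_measure. f z) = integral {0..2 * pi} (\<lambda>t. f (cis t)) / (2 * pi)"
proof -
  let ?I = "{0..<2 * pi}"
  have cis: "cis \<in> measurable borel (restrict_space borel (sphere 0 1))"
    by (rule measurable_restrict_space2)
      (auto intro!: borel_measurable_continuous_onI continuous_intros)
  have f: "f \<in> borel_measurable (restrict_space borel (sphere 0 1))"
    using assms(1) by (simp add: circle_measure_def)
  have [measurable]: "(\<lambda>t. f (cis t)) \<in> borel_measurable lborel"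
    using measurable_compose[OF cis f] by simp
  have U: "uniform_measure lborel ?I = density lborel (\<lambda>t. ennreal (indicator ?I t / (2 * pi)))"
    unfolding uniform_measure_def
    by (intro arg_cong[where f="density lborel"] ext)
      (auto simp: divide_ennreal[symmetric] ennreal_indicator split: split_indicator)
  have "(LINT z|circle_measure. f z) = (LINT t|uniform_measure lborel ?I. f (cis t))"
    unfolding circle_measure_def using cis f
    by (intro integral_distr) (auto cong: measurable_cong_sets)
  also have "\<dots> = (LINT t|lborel. (indicator ?I t / (2 * pi)) *\<^sub>R f (cis t))"
    unfolding U by (rule integral_density) auto
  also have "\<dots> = (LINT t|lborel. (1 / (2 * pi)) *\<^sub>R (indicator ?I t *\<^sub>R f (cis t)))"
    by (intro Bochner_Integration.integral_cong) auto
  also have "\<dots> = (1 / (2 * pi)) *\<^sub>R (LINT t:?I|lborel. f (cis t))"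
    unfolding set_lebesgue_integral_def by (rule integral_scaleR_right)
  \<comment> \<open>The two intervals differ by the null set consisting of the point
    \<open>2 * pi\<close>.\<close>
  also have "(LINT t:?I|lborel. f (cis t)) = (LINT t:{0..2 * pi}|lborel. f (cis t))"
    unfolding set_lebesgue_integral_def
  proof (rule integral_cong_AE)
    have "AE t in lborel. t \<noteq> 2 * pi" by (rule AE_lborel_singleton)
    then show "AE t in lborel. indicat_real ?I t *\<^sub>R f (cis t) =
        indicat_real {0..2 * pi} t *\<^sub>R f (cis t)"
      by eventually_elim (auto simp: indicator_def)
  qed measurable
  also have "\<dots> = integral {0..2 * pi} (\<lambda>t. f (cis t))"
    by (rule set_borel_integral_eq_integral(2)) (rule borel_integrable_atLeastAtMost'[OF assms(2)])
  finally show ?thesis by (simp add: scaleR_conv_of_real)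
qed

text \<open>Cauchy's integral formula at the centre: on a circle about 0, \<open>dz / z\<close> is
  \<open>\<i> dt\<close>.\<close>

lemma circle_mean_value:
  assumes "h holomorphic_on ball 0 1" "0 < r" "r < 1"
  shows "(LINT z|circle_measure. h (of_real r * z)) = h 0"
proof -
  have cont: "continuous_on (ball 0 1) h"
    using assms(1) by (rule holomorphic_on_imp_continuous_on)
  have "h holomorphic_on cball 0 r"
    using assms by (auto intro: holomorphic_on_subset)
  then have "((\<lambda>u. h u / (u - 0)) has_contour_integral (2 * of_real pi * \<i> * h 0)) (circlepath 0 r)"
    using assms by (intro Cauchy_integral_circlepath_simple) auto
  then have "((\<lambda>t. h (r * cis t) / (r * cis t) * r * \<i> * cis t) has_integral 2 * of_real pi * \<i> * h 0)
      {0..2 * pi}"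
    unfolding circlepath_def by (subst (asm) has_contour_integral_part_circlepath_iff) auto
  then have "((\<lambda>t. \<i> * h (r * cis t)) has_integral 2 * of_real pi * \<i> * h 0) {0..2 * pi}"
    using assms(2) by (simp add: mult.commute)
  \<comment> \<open>Multiplying by \<open>- \<i>\<close> removes the factor \<open>\<i>\<close> left
    by the parametrization.\<close>
  from has_integral_mult_right[OF this, of "- \<i>"]
  have 1: "((\<lambda>t. h (r * cis t)) has_integral 2 * of_real pi * h 0) {0..2 * pi}"
    by (simp add: algebra_simps)
  have "(\<lambda>z. h (of_real r * z)) \<in> borel_measurable (restrict_space borel (sphere 0 1))"
    using assms by (intro borel_measurable_continuous_on_restrict
        continuous_on_compose2[OF cont] continuous_intros) (auto simp: norm_mult)
  then have "(\<lambda>z. h (of_real r * z)) \<in> borel_measurable circle_measure"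
    by (simp add: circle_measure_def)
  then have "(LINT z|circle_measure. h (of_real r * z)) =
      integral {0..2 * pi} (\<lambda>t. h (r * cis t)) / (2 * pi)"
    using assms
    by (intro integral_circle_measure[where f="\<lambda>z. h (of_real r * z)"]
        continuous_on_compose2[OF cont] continuous_intros) (auto simp: norm_mult)
  then show ?thesis
    using integral_unique[OF 1] by simp
qed

lemma integral_circle_powi:
  "(LINT z|circle_measure. z powi n) = (if n = 0 then 1 else 0)"
proof -
  have pos: "(LINT z|circle_measure. z ^ k) = 0" if "k > 0" for k :: nat
  proof -
    \<comment> \<open>The mean value property is available for radii below 1; the nonzero factor
      \<open>(1 / 2) ^ k\<close> then splits off the integral.\<close>
    have "(LINT z|circle_measure. (of_real (1 / 2) * z) ^ k) = 0"
      using circle_mean_value[of "\<lambda>z. z ^ k" "1 / 2"] that by (simp add: holomorphic_on_power)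
    then show ?thesis by (simp add: power_mult_distrib del: of_real_divide)
  qed
  interpret prob_space circle_measure by (rule prob_space_circle_measure)
  consider "n = 0" | k where "n = int k" "k > 0" | k where "n = - int k" "k > 0"
    by (metis gr0I int_cases2 minus_zero of_nat_0)
  then show ?thesis
  proof cases
    case 3
    have "(LINT z|circle_measure. z powi n) = (LINT z|circle_measure. cnj (z ^ k))"
    proof (rule Bochner_Integration.integral_cong)
      fix z assume "z \<in> space circle_measure"
      then have "inverse z = cnj z" by (simp add: inverse_eq_divide divide_conv_cnj)
      then show "z powi n = cnj (z ^ k)"
        using 3 by (simp add: power_int_minus power_inverse[symmetric])
    qed simp
    also have "\<dots> = cnj (LINT z|circle_measure. z ^ k)" by (rule Bochner_Integration.integral_cnj)
    finally show ?thesis using 3 pos by simp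
  qed (use pos prob_space in auto)
qed

lemma inverse_eq_cnj: "cmod z = 1 \<Longrightarrow> inverse z = cnj z"
  by (simp add: inverse_eq_divide divide_conv_cnj)

lemma cnj_powi_circle: "cmod z = 1 \<Longrightarrow> cnj z powi n = z powi (- n)"
  by (metis inverse_eq_cnj power_int_inverse power_int_minus)

section \<open>The powers of z as an orthonormal system in \<open>L2\<close>\<close>

lemma measurable_powi_circle [measurable]:
  "(\<lambda>z. z powi n) \<in> borel_measurable circle_measure"
proof -
  have [measurable]: "(\<lambda>z::complex. z) \<in> borel_measurable circle_measure"
    by (rule borel_measurable_circle_continuous) simp
  show ?thesis unfolding power_int_def by measurable
qed

lemma square_integrable_powi_mult: "square_integrable f \<Longrightarrow> square_integrable (\<lambda>z. z powi n * f z)"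
  by (rule square_integrable_bounded_mult[where B=1]) (auto simp: norm_power_int)

lift_definition z_powi :: "int \<Rightarrow> L2" is "\<lambda>n z. z powi n"
  using square_integrable_powi_mult[OF square_integrable_const[of 1]] by (auto simp: L2_rel_def)

lemma z_powi_0: "z_powi 0 = one_L2"
  by transfer (simp add: L2_rel_def square_integrable_const)

lemma z_powi_m1: "z_powi (-1) = zbar_L2"
proof transfer
  have "z powi -1 = cnj z" if "cmod z = 1" for z
    using that cnj_powi_circle[of z 1] by simp
  then show "L2_rel (\<lambda>z. z powi -1) cnj"
    using square_integrable_powi_mult[OF square_integrable_const[of 1], of "-1"]
      square_integrable_cnj[OF square_integrable_id_mult[OF square_integrable_const[of 1]]]
    by (auto simp: L2_rel_def intro: AE_I2)
qed

lemma fourier_coeff_eq_cinner: "fourier_coeff f n = cinner f (z_powi n)"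
  by transfer (auto intro!: Bochner_Integration.integral_cong simp: cnj_powi_circle)

lemma cinner_z_powi: "cinner (z_powi m) (z_powi n) = (if m = n then 1 else 0)"
proof -
  have "cinner (z_powi m) (z_powi n) = (LINT z|circle_measure. z powi (m - n))"
  proof transfer
    fix m n :: int
    have "z powi m * cnj (z powi n) = z powi (m - n)" if "cmod z = 1" for z
      using that power_int_add[of z m "- n"] by (force simp: cnj_powi_circle)
    then show "(LINT z|circle_measure. z powi m * cnj (z powi n)) =
        (LINT z|circle_measure. z powi (m - n))"
      by (intro Bochner_Integration.integral_cong) auto
  qed
  then show ?thesis by (simp add: integral_circle_powi)
qed

lemma cinner_mult_z_z_powi: "cinner (mult_z f) (z_powi n) = cinner f (z_powi (n - 1))"
proof transfer
  fix f n
  have "z * f z * cnj (z powi n) = f z * cnj (z powi (n - 1))" if "cmod z = 1" for z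
  proof -
    have "z * z powi (- n) = z powi (1 - n)"
      using that power_int_add[of z 1 "-n"] by force
    then show ?thesis using that by (auto simp: cnj_powi_circle)
  qed
  then show "(LINT z|circle_measure. z * f z * cnj (z powi n)) =
      (LINT z|circle_measure. f z * cnj (z powi (n - 1)))"
    by (intro Bochner_Integration.integral_cong) auto
qed

lemma cinner_cnj_L2_z_powi: "cinner (cnj_L2 f) (z_powi n) = cnj (cinner f (z_powi (- n)))"
proof transfer
  fix f n
  have "(LINT z|circle_measure. cnj (f z) * cnj (z powi n)) =
      (LINT z|circle_measure. cnj (f z * cnj (z powi (- n))))"
    by (intro Bochner_Integration.integral_cong) (auto simp: cnj_powi_circle)
  then show "(LINT z|circle_measure. cnj (f z) * cnj (z powi n)) =
      cnj (LINT z|circle_measure. f z * cnj (z powi (- n)))"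
    by (simp only: Bochner_Integration.integral_cnj)
qed

lemma cnj_L2_mult_z_involution: "cnj_L2 (mult_z (cnj_L2 (mult_z f))) = f"
proof transfer
  fix f assume f: "L2_rel f f"
  have "cnj z * z = 1" if "cmod z = 1" for z
    using that complex_norm_square[of z] by (simp add: mult.commute)
  then have "AE z in circle_measure. cnj (z * cnj (z * f z)) = f z"
    by (intro AE_I2) (simp add: mult.assoc[symmetric])
  then show "L2_rel (\<lambda>z. cnj (z * cnj (z * f z))) f"
    using f square_integrable_cnj[OF square_integrable_id_mult[OF square_integrable_cnj[OF square_integrable_id_mult]], of f]
    by (auto simp: L2_rel_def simp del: complex_cnj_mult)
qed

lemma H2_iff: "f \<in> H2 \<longleftrightarrow> (\<forall>n<0. cinner f (z_powi n) = 0)"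
  by (simp add: H2_def fourier_coeff_eq_cinner)

text \<open>The map sending \<open>f\<close> to the conjugate of \<open>z f\<close> is an
  involution. It takes the coefficient of index \<open>- n - 1\<close> to the conjugate coefficient
  of index \<open>n\<close>, so it exchanges negative and nonnegative indices.\<close>

lemma H2_0_bar_iff: "f \<in> H2_0_bar \<longleftrightarrow> (\<forall>n\<ge>0. cinner f (z_powi n) = 0)"
proof -
  have 1: "cinner (cnj_L2 (mult_z g)) (z_powi n) = cnj (cinner g (z_powi (- n - 1)))" for g n
    by (simp add: cinner_cnj_L2_z_powi cinner_mult_z_z_powi)
  have "cnj_L2 (mult_z f) \<in> H2" if "\<forall>n\<ge>0. cinner f (z_powi n) = 0"
    using that by (simp add: H2_iff 1)
  then have "f \<in> H2_0_bar" if "\<forall>n\<ge>0. cinner f (z_powi n) = 0"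
    using that cnj_L2_mult_z_involution[of f] unfolding H2_0_bar_def by force
  moreover have "cinner f (z_powi n) = 0" if "f \<in> H2_0_bar" "n \<ge> 0" for n
    using that 1 by (auto simp: H2_0_bar_def H2_iff)
  ultimately show ?thesis by auto
qed

section \<open>Totality of the trigonometric system\<close>

text \<open>Stated for functions rather than classes, so that pointwise multipliers can be applied.
  No conjugate is taken because \<open>n\<close> runs over all integers.\<close>

definition fourier_null :: "(complex \<Rightarrow> complex) \<Rightarrow> bool" where
  "fourier_null F \<longleftrightarrow> square_integrable F \<and> (\<forall>n. (LINT z|circle_measure. z powi n * F z) = 0)"

lemma integrable_powi_mult:
  assumes "square_integrable F"
  shows "integrable circle_measure (\<lambda>z. z powi n * F z)"
  using square_integrable_cinner[OF square_integrable_powi_mult[OF assms] square_integrable_const[of 1], of n]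
  by simp

lemma square_integrable_integrable: "square_integrable F \<Longrightarrow> integrable circle_measure F"
  using integrable_powi_mult[of F 0] by simp

lemma fourier_null_add: "fourier_null F \<Longrightarrow> fourier_null G \<Longrightarrow> fourier_null (\<lambda>z. F z + G z)"
  by (simp add: fourier_null_def square_integrable_add distrib_left integrable_powi_mult)

lemma fourier_null_scale: "fourier_null F \<Longrightarrow> fourier_null (\<lambda>z. c * F z)"
  by (simp add: fourier_null_def square_integrable_scale mult.left_commute[of _ c])

lemma fourier_null_powi_mult:
  assumes "fourier_null F"
  shows "fourier_null (\<lambda>z. z powi m * F z)"
  unfolding fourier_null_def
proof (intro conjI allI)
  fix n
  have "(LINT z|circle_measure. z powi n * (z powi m * F z)) = (LINT z|circle_measure. z powi (n + m) * F z)"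
  proof (intro Bochner_Integration.integral_cong refl)
    fix z assume "z \<in> space circle_measure"
    then have "z \<noteq> 0" by auto
    then show "z powi n * (z powi m * F z) = z powi (n + m) * F z"
      by (simp add: power_int_add)
  qed
  then show "(LINT z|circle_measure. z powi n * (z powi m * F z)) = 0"
    using assms by (simp add: fourier_null_def)
qed (use assms square_integrable_powi_mult in \<open>auto simp: fourier_null_def\<close>)

lemma fourier_null_cong:
  assumes "fourier_null F" "\<And>z. cmod z = 1 \<Longrightarrow> F z = G z"
  shows "fourier_null G"
proof -
  have "square_integrable F" using assms(1) by (simp add: fourier_null_def)
  then have "square_integrable G"
    using assms(2) measurable_cong[of circle_measure F G borel]
      Bochner_Integration.integrable_cong[of circle_measure circle_measure
        "\<lambda>z. (cmod (F z))\<^sup>2" "\<lambda>z. (cmod (G z))\<^sup>2"]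
    by (simp add: square_integrable_def)
  moreover have "(LINT z|circle_measure. z powi n * G z) = (LINT z|circle_measure. z powi n * F z)" for n
    using assms(2) by (intro Bochner_Integration.integral_cong) auto
  ultimately show ?thesis
    using assms(1) by (auto simp: fourier_null_def)
qed

text \<open>On the circle \<open>Re z\<close> is half the sum of \<open>z\<close> and its inverse,
  and both powers preserve nullity. With the analogous fact for \<open>Im z\<close>, this supplies
  the coordinate functions that separate points in Stone-Weierstrass.\<close>

lemma fourier_null_Re_mult:
  assumes "fourier_null F"
  shows "fourier_null (\<lambda>z. of_real (Re z) * F z)"
proof (rule fourier_null_cong)
  show "fourier_null (\<lambda>z. 1 / 2 * (z powi 1 * F z + z powi (-1) * F z))"
    by (intro fourier_null_scale fourier_null_add fourier_null_powi_mult assms)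
  fix z :: complex assume "cmod z = 1"
  then have "z powi (-1) = cnj z" by (simp add: inverse_eq_cnj)
  then show "1 / 2 * (z powi 1 * F z + z powi (-1) * F z) = of_real (Re z) * F z"
    by (simp add: distrib_right[symmetric] complex_add_cnj del: distrib_right_numeral)
qed

lemma fourier_null_Im_mult:
  assumes "fourier_null F"
  shows "fourier_null (\<lambda>z. of_real (Im z) * F z)"
proof (rule fourier_null_cong)
  show "fourier_null (\<lambda>z. - \<i> / 2 * (z powi 1 * F z + - 1 * (z powi (-1) * F z)))"
    by (intro fourier_null_scale fourier_null_add fourier_null_powi_mult assms)
  fix z :: complex assume "cmod z = 1"
  then have 1: "z powi (-1) = cnj z" by (simp add: inverse_eq_cnj)
  have 2: "of_real (Im z) = - \<i> / 2 * (z - cnj z)"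
    by (simp add: complex_diff_cnj complex_eq_iff)
  show "- \<i> / 2 * (z powi 1 * F z + - 1 * (z powi (-1) * F z)) = of_real (Im z) * F z"
    unfolding 1 2 by (simp add: field_simps)
qed

text \<open>Real multipliers that preserve nullity form an algebra containing the constants and
  separating points, so one of them, \<open>p\<close>, is within \<open>e\<close> of
  \<open>\<phi>\<close> on the circle. As \<open>p F\<close> has integral 0, the integral of
  \<open>\<phi> F\<close> is at most \<open>e\<close> times the L1 norm of \<open>F\<close>.\<close>

lemma fourier_null_integral_continuous:
  fixes \<phi> :: "complex \<Rightarrow> real"
  assumes F: "fourier_null F" and \<phi>: "continuous_on UNIV \<phi>"
  shows "(LINT z|circle_measure. of_real (\<phi> z) * F z) = 0"
proof -
  \<comment> \<open>Quantifying over all null functions closes \<open>P\<close> under products: the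
    two multipliers are applied one after the other.\<close>
  define P where "P = (\<lambda>p :: complex \<Rightarrow> real. continuous_on UNIV p \<and>
    (\<forall>F. fourier_null F \<longrightarrow> fourier_null (\<lambda>z. of_real (p z) * F z)))"
  have int: "integrable circle_measure F"
    using F by (simp add: fourier_null_def square_integrable_integrable)
  define K where "K = (LINT z|circle_measure. cmod (F z))"
  have "cmod (LINT z|circle_measure. of_real (\<phi> z) * F z) \<le> e * K" if "e > 0" for e
  proof -
    have "\<exists>p. P p \<and> (\<forall>x\<in>sphere 0 1. \<bar>\<phi> x - p x\<bar> < e)"
    proof (rule Stone_Weierstrass_HOL)
      show "P (\<lambda>x. c)" for c
        by (auto simp: P_def intro: fourier_null_scale)
      show "P (\<lambda>x. f x + g x)" if "P f \<and> P g" for f g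
        using that by (auto simp: P_def distrib_right intro!: continuous_intros fourier_null_add)
      show "P (\<lambda>x. f x * g x)" if "P f \<and> P g" for f g
        using that by (auto simp: P_def mult.assoc intro!: continuous_intros)
      have "P Re" "P Im"
        by (auto simp: P_def intro: fourier_null_Re_mult fourier_null_Im_mult
            intro!: continuous_intros)
      then show "\<exists>f. P f \<and> f x \<noteq> f y" if "x \<in> sphere 0 1 \<and> y \<in> sphere 0 1 \<and> x \<noteq> y" for x y
        using that by (metis complex_eqI)
    qed (use \<phi> that in \<open>auto simp: P_def intro: continuous_on_subset\<close>)
    then obtain p where p: "P p" "\<And>x. cmod x = 1 \<Longrightarrow> \<bar>\<phi> x - p x\<bar> < e" by auto
    have pF: "fourier_null (\<lambda>z. of_real (p z) * F z)" using p(1) F by (simp add: P_def)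
    then have int_p: "integrable circle_measure (\<lambda>z. of_real (p z) * F z)"
      by (simp add: fourier_null_def square_integrable_integrable)
    have p0: "(LINT z|circle_measure. of_real (p z) * F z) = 0"
      using pF by (auto simp: fourier_null_def dest: spec[of _ 0])
    have meas: "(\<lambda>z. of_real (\<phi> z)::complex) \<in> borel_measurable circle_measure"
      using \<phi> by (intro borel_measurable_circle_continuous continuous_intros)
    have [measurable]: "F \<in> borel_measurable circle_measure" using int by measurable
    have le: "cmod (of_real (\<phi> z) * F z - of_real (p z) * F z) \<le> e * cmod (F z)" if "cmod z = 1" for z
      using p(2)[OF that]
      by (simp add: left_diff_distrib[symmetric] norm_mult of_real_diff[symmetric]
          mult_right_mono less_imp_le del: of_real_diff)
    have int_d: "integrable circle_measure (\<lambda>z. of_real (\<phi> z) * F z - of_real (p z) * F z)"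
    proof (rule Bochner_Integration.integrable_bound)
      show "integrable circle_measure (\<lambda>z. e * cmod (F z))" using int by simp
      show "AE z in circle_measure. norm (of_real (\<phi> z) * F z - of_real (p z) * F z) \<le> norm (e * cmod (F z))"
        using le that by (intro AE_I2) auto
    qed (use meas int_p in measurable)
    have "(LINT z|circle_measure. of_real (\<phi> z) * F z) =
        (LINT z|circle_measure. (of_real (\<phi> z) * F z - of_real (p z) * F z) + of_real (p z) * F z)"
      by simp
    also have "\<dots> = (LINT z|circle_measure. of_real (\<phi> z) * F z - of_real (p z) * F z)"
      using Bochner_Integration.integral_add[OF int_d int_p] p0 by simp
    also have "cmod \<dots> \<le> (LINT z|circle_measure. cmod (of_real (\<phi> z) * F z - of_real (p z) * F z))"
      by (rule integral_norm_bound)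
    also have "\<dots> \<le> (LINT z|circle_measure. e * cmod (F z))"
      using int_d int le by (intro integral_mono) auto
    finally show ?thesis by (simp add: K_def)
  qed
  \<comment> \<open>The bound holds for every \<open>e > 0\<close>; it is now passed to the limit at
    0 from the right.\<close>
  then have "((\<lambda>e. e * K) \<longlongrightarrow> 0 * K) (at_right 0) \<Longrightarrow>
      cmod (LINT z|circle_measure. of_real (\<phi> z) * F z) \<le> 0 * K"
    by (intro tendsto_lowerbound[of "\<lambda>e. e * K" _ "at_right 0"])
      (auto simp: eventually_at_filter)
  moreover have "((\<lambda>e. e * K) \<longlongrightarrow> 0 * K) (at_right 0)"
    by (intro tendsto_intros)
  ultimately show ?thesis by simp
qed

section \<open>From continuous multipliers to Borel sets\<close>

lemma sets_circle_measure: "sets circle_measure = sets (restrict_space borel (sphere 0 1))"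
  by (simp add: circle_measure_def)

text \<open>Off the closed set the distance is positive, so the truncated functions are eventually
  0. For the empty set \<open>infdist\<close> is 0 by convention and the limit would be 1.\<close>

lemma indicator_limit_continuous:
  fixes C :: "complex set"
  assumes "closed C" "C \<noteq> {}"
  shows "(\<lambda>n. max 0 (1 - real n * infdist z C)) \<longlonglongrightarrow> indicator C z"
proof (cases "z \<in> C")
  case False
  then have pos: "infdist z C > 0"
    using assms by (metis in_closed_iff_infdist_zero infdist_nonneg less_eq_real_def)
  obtain N where N: "real N * infdist z C > 1"
    using reals_Archimedean3[OF pos] by blast
  have "max 0 (1 - real n * infdist z C) = 0" if "n \<ge> N" for n
  proof -
    have "real N * infdist z C \<le> real n * infdist z C"
      using that pos by (intro mult_right_mono) auto
    then show ?thesis using N by simp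
  qed
  then have "\<forall>\<^sub>F n in sequentially. max 0 (1 - real n * infdist z C) = 0"
    by (auto simp: eventually_sequentially)
  then show ?thesis using False by (simp add: tendsto_eventually)
qed simp

text \<open>Dynkin's pi-lambda argument with the closed sets as intersection-stable generator.
  Closed sets follow by dominated convergence from continuous multipliers, complements because the
  total integral is 0, disjoint unions by countable additivity.\<close>

lemma fourier_null_set_integral:
  assumes F: "fourier_null F" and A: "A \<in> sets borel"
  shows "(LINT z:A \<inter> sphere 0 1|circle_measure. F z) = 0"
proof -
  have int: "integrable circle_measure F"
    using F by (simp add: fourier_null_def square_integrable_integrable)
  then have [measurable]: "F \<in> borel_measurable circle_measure" by measurable
  have set_int: "set_integrable circle_measure (B \<inter> sphere 0 1) F" if "B \<in> sets borel" for B
    unfolding set_integrable_def using that int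
    by (intro integrable_mult_indicator) (auto simp: sets_circle_measure sets_restrict_space)
  have tot: "(LINT z|circle_measure. F z) = 0"
    using fourier_null_integral_continuous[OF F, of "\<lambda>_. 1"] by simp
  have "Int_stable (Collect closed :: complex set set)" "Collect closed \<subseteq> Pow (UNIV :: complex set)"
      "A \<in> sigma_sets UNIV (Collect closed)"
    using A by (auto simp: borel_eq_closed Int_stable_def)
  then show ?thesis
  proof (induction rule: sigma_sets_induct_disjoint)
    case (basic C)
    then have C: "closed C" by simp
    show ?case
    proof (cases "C = {}")
      case False
      have "(\<lambda>n. LINT z|circle_measure. complex_of_real (max 0 (1 - real n * infdist z C)) * F z)
          \<longlonglongrightarrow> (LINT z|circle_measure. complex_of_real (indicator C z) * F z)"
      proof (rule integral_dominated_convergence[where w="\<lambda>z. cmod (F z)"])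
        have "(\<lambda>z. complex_of_real (indicator C z)) \<in> borel_measurable circle_measure"
          using C unfolding circle_measure_def measurable_distr_eq1
          by (intro measurable_restrict_space1) auto
        then show "(\<lambda>z. complex_of_real (indicator C z) * F z) \<in> borel_measurable circle_measure"
          by measurable
        show "(\<lambda>z. complex_of_real (max 0 (1 - real n * infdist z C)) * F z)
            \<in> borel_measurable circle_measure" for n
        proof -
          have [measurable]: "(\<lambda>z. complex_of_real (max 0 (1 - real n * infdist z C)))
              \<in> borel_measurable circle_measure"
            by (intro borel_measurable_circle_continuous continuous_intros)
          show ?thesis by measurable
        qed
        show "AE z in circle_measure. norm (complex_of_real (max 0 (1 - real n * infdist z C)) * F z)
            \<le> cmod (F z)" for n
          by (intro AE_I2) (auto simp: norm_mult infdist_nonneg intro!: mult_left_le_one_le)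
        show "AE z in circle_measure. (\<lambda>n. complex_of_real (max 0 (1 - real n * infdist z C)) * F z)
            \<longlonglongrightarrow> complex_of_real (indicator C z) * F z"
          by (intro AE_I2 tendsto_intros indicator_limit_continuous C False)
      qed (use int in auto)
      moreover have "(LINT z|circle_measure. complex_of_real (max 0 (1 - real n * infdist z C)) * F z) = 0" for n
        by (intro fourier_null_integral_continuous[OF F] continuous_intros)
      ultimately have "(LINT z|circle_measure. complex_of_real (indicator C z) * F z) = 0"
        by (simp add: LIMSEQ_const_iff)
      also have "(LINT z|circle_measure. complex_of_real (indicator C z) * F z) =
          (LINT z:C \<inter> sphere 0 1|circle_measure. F z)"
        unfolding set_lebesgue_integral_def
        by (intro Bochner_Integration.integral_cong) (auto simp: indicator_def)
      finally show ?thesis .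
    qed (simp add: set_lebesgue_integral_def)
  next
    case empty
    show ?case by (simp add: set_lebesgue_integral_def)
  next
    case (compl B)
    then have B: "B \<in> sets borel" by (simp add: borel_eq_closed)
    have "(LINT z:(UNIV - B) \<inter> sphere 0 1|circle_measure. F z) =
        (LINT z|circle_measure. F z - indicat_real (B \<inter> sphere 0 1) z *\<^sub>R F z)"
      unfolding set_lebesgue_integral_def
      by (intro Bochner_Integration.integral_cong) (auto simp: indicator_def)
    also have "\<dots> = 0"
      using int set_int[OF B] compl.IH tot
      by (simp add: set_lebesgue_integral_def set_integrable_def)
    finally show ?case .
  next
    case (union B)
    then have B: "range B \<subseteq> sets borel" by (simp add: borel_eq_closed)
    then have "(LINT z:(\<Union>i. B i \<inter> sphere 0 1)|circle_measure. F z) =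
        (\<Sum>i. (LINT z:B i \<inter> sphere 0 1|circle_measure. F z))"
      using union.hyps(1) set_int[of "\<Union>i. B i"]
      by (intro lebesgue_integral_countable_add)
        (auto simp: sets_circle_measure sets_restrict_space disjoint_family_on_def)
    moreover have "(\<Union>i. B i \<inter> sphere 0 1) = (\<Union>i. B i) \<inter> sphere 0 1" by auto
    ultimately show ?case using union.IH by simp
  qed
qed

lemma fourier_null_AE_zero:
  assumes "fourier_null F"
  shows "AE z in circle_measure. F z = 0"
proof -
  interpret prob_space circle_measure by (rule prob_space_circle_measure)
  show ?thesis
  proof (rule density_zero)
  show "integrable circle_measure F"
    using assms by (simp add: fourier_null_def square_integrable_integrable)
  fix A assume "A \<in> sets circle_measure"
  then obtain B where "B \<in> sets borel" "A = B \<inter> sphere 0 1"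
    by (auto simp: sets_circle_measure sets_restrict_space)
  then show "(LINT z:A|circle_measure. F z) = 0"
    using fourier_null_set_integral[OF assms] by auto
  qed
qed

text \<open>Totality of the powers of z on the level of classes: a function whose integral over
  every measurable set is 0 vanishes almost everywhere.\<close>

lemma L2_eq_zeroI:
  assumes "\<And>n. cinner f (z_powi n) = 0"
  shows "f = 0"
  using assms
proof (transfer fixing: )
  fix f assume f: "L2_rel f f" and "\<And>n. (LINT z|circle_measure. f z * cnj (z powi n)) = 0"
  then have 0: "(LINT z|circle_measure. f z * cnj (z powi n)) = 0" for n by blast
  have "(LINT z|circle_measure. z powi n * f z) = (LINT z|circle_measure. f z * cnj (z powi (- n)))" for n
    by (intro Bochner_Integration.integral_cong) (auto simp: cnj_powi_circle)
  then have "fourier_null f"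
    using f 0 by (simp add: fourier_null_def L2_rel_def)
  then show "L2_rel f (\<lambda>_. 0)"
    using f fourier_null_AE_zero by (simp add: L2_rel_def square_integrable_const)
qed

section \<open>Riesz-Fischer and the decomposition of L2\<close>

lemma square_integrable_rep_L2 [simp]: "square_integrable (rep_L2 f)"
  using Quotient3_rep_reflp[OF Quotient3_L2, of f] by (simp add: L2_rel_def)

lemma L2_eq_iff_AE: "f = g \<longleftrightarrow> (AE z in circle_measure. rep_L2 f z = rep_L2 g z)"
  using Quotient3_rel_rep[OF Quotient3_L2, of f g] by (auto simp: L2_rel_def)

lemma rep_abs_L2:
  assumes "square_integrable F"
  shows "AE z in circle_measure. rep_L2 (abs_L2 F) z = F z"
  using Quotient3_rep_abs[OF Quotient3_L2, of F] assms by (simp add: L2_rel_def)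

lemma sqnorm_eq_integral: "sqnorm f = (LINT z|circle_measure. (cmod (rep_L2 f z))\<^sup>2)"
proof -
  have "cinner f f = (LINT z|circle_measure. rep_L2 f z * cnj (rep_L2 f z))"
    by (simp add: cinner_L2.rep_eq)
  also have "\<dots> = complex_of_real (LINT z|circle_measure. (cmod (rep_L2 f z))\<^sup>2)"
    unfolding integral_complex_of_real[symmetric] complex_norm_square ..
  finally show ?thesis by (simp add: sqnorm_def)
qed

lemma rep_L2_diff: "AE z in circle_measure. rep_L2 (f - g) z = rep_L2 f z - rep_L2 g z"
proof -
  have "abs_L2 (\<lambda>z. rep_L2 f z + - 1 * rep_L2 g z) = abs_L2 (rep_L2 f) + (- 1) *\<^sub>C abs_L2 (rep_L2 g)"
    by (subst scaleC_L2.abs_eq, simp add: L2_rel_def, subst plus_L2.abs_eq)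
      (simp_all add: L2_rel_def square_integrable_scale[where c="-1", simplified])
  then have "f - g = abs_L2 (\<lambda>z. rep_L2 f z + - 1 * rep_L2 g z)"
    by (simp add: minus_L2_def uminus_L2_def Quotient3_abs_rep[OF Quotient3_L2])
  moreover have "square_integrable (\<lambda>z. rep_L2 f z + - 1 * rep_L2 g z)"
    by (intro square_integrable_add square_integrable_scale square_integrable_rep_L2)
  ultimately show ?thesis
    using rep_abs_L2[of "\<lambda>z. rep_L2 f z + - 1 * rep_L2 g z"] by simp
qed

lemma measurable_rep_L2 [measurable]: "rep_L2 f \<in> borel_measurable circle_measure"
  by (simp add: square_integrableD)

lemma sqnorm_diff_eq_integral:
  "sqnorm (f - g) = (LINT z|circle_measure. (cmod (rep_L2 f z - rep_L2 g z))\<^sup>2)"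
  unfolding sqnorm_eq_integral using rep_L2_diff[of f g]
  by (intro integral_cong_AE) auto

lemma square_integrable_rep_diff: "square_integrable (\<lambda>z. rep_L2 f z - rep_L2 g z)"
  using square_integrable_add[OF square_integrable_rep_L2[of f] square_integrable_scale[OF square_integrable_rep_L2[of g], of "-1"]]
  by simp

lemma nn_integral_diff_eq_sqnorm:
  "(\<integral>\<^sup>+z. ennreal ((cmod (rep_L2 f z - rep_L2 g z))\<^sup>2) \<partial>circle_measure) = ennreal (sqnorm (f - g))"
  unfolding sqnorm_diff_eq_integral
  using square_integrable_rep_diff[of f g]
  by (intro nn_integral_eq_integral) (auto simp: square_integrable_def)

text \<open>For a probability measure this is nonnegativity of the variance. It makes a sequence
  that is Cauchy in L2 also Cauchy in L1.\<close>

lemma integral_diff_le_sqnorm: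
  "(LINT z|circle_measure. cmod (rep_L2 f z - rep_L2 g z))\<^sup>2 \<le> sqnorm (f - g)"
proof -
  interpret prob_space circle_measure by (rule prob_space_circle_measure)
  let ?X = "\<lambda>z. cmod (rep_L2 f z - rep_L2 g z)"
  have "integrable circle_measure ?X" "integrable circle_measure (\<lambda>z. (?X z)\<^sup>2)"
    using square_integrable_rep_diff[of f g] square_integrable_integrable[OF square_integrable_rep_diff[of f g]]
    by (auto simp: square_integrable_def)
  then show ?thesis
    using variance_eq[of ?X] variance_positive[of ?X] by (simp add: sqnorm_diff_eq_integral)
qed

text \<open>Being Cauchy in L1, the representatives have a subsequence that converges almost
  everywhere; Fatou's lemma shows that its pointwise limit is also the limit in L2.\<close>

lemma L2_complete:
  assumes "\<And>e. e > 0 \<Longrightarrow> \<exists>N. \<forall>m\<ge>N. \<forall>n\<ge>N. sqnorm (X m - X n) < e"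
  obtains L :: L2 where "(\<lambda>n. sqnorm (X n - L)) \<longlonglongrightarrow> 0"
proof -
  interpret prob_space circle_measure by (rule prob_space_circle_measure)
  define x where "x n = rep_L2 (X n)" for n
  have [measurable]: "x n \<in> borel_measurable circle_measure" for n
    unfolding x_def by measurable
  have L1: "\<exists>N. \<forall>i\<ge>N. \<forall>j\<ge>N. (LINT z|circle_measure. norm (x i z - x j z)) < e" if "e > 0" for e
  proof -
    obtain N where N: "\<forall>i\<ge>N. \<forall>j\<ge>N. sqnorm (X i - X j) < e\<^sup>2"
      using assms[of "e\<^sup>2"] \<open>e > 0\<close> by auto
    show ?thesis
    proof (intro exI[of _ N] allI impI)
      fix i j assume "i \<ge> N" "j \<ge> N"
      then have "(LINT z|circle_measure. norm (x i z - x j z))\<^sup>2 < e\<^sup>2"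
        using N integral_diff_le_sqnorm[of "X i" "X j"] unfolding x_def by (meson le_less_trans)
      then show "(LINT z|circle_measure. norm (x i z - x j z)) < e"
        using \<open>e > 0\<close> by (simp add: power_less_imp_less_base)
    qed
  qed
  have "integrable circle_measure (x n)" for n
    unfolding x_def by (simp add: square_integrable_integrable)
  from cauchy_L1_AE_cauchy_subseq[OF this L1]
  obtain r where r: "strict_mono r" "AE z in circle_measure. Cauchy (\<lambda>i. x (r i) z)" by metis
  define l where "l z = lim (\<lambda>i. x (r i) z)" for z
  have [measurable]: "l \<in> borel_measurable circle_measure"
    unfolding l_def by measurable
  have lim: "AE z in circle_measure. (\<lambda>i. x (r i) z) \<longlonglongrightarrow> l z"
    using r(2) by eventually_elim (simp add: l_def Cauchy_convergent_iff convergent_LIMSEQ_iff)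
  \<comment> \<open>The nonnegative integral is used because square integrability of
    \<open>l\<close> is not yet known; it is deduced from this bound.\<close>
  have Fatou: "(\<integral>\<^sup>+z. ennreal ((cmod (x n z - l z))\<^sup>2) \<partial>circle_measure) \<le> ennreal e"
    if N: "\<forall>i\<ge>N. \<forall>j\<ge>N. sqnorm (X i - X j) < e" and "n \<ge> N" for n N e
  proof -
    have "(\<integral>\<^sup>+z. ennreal ((cmod (x n z - l z))\<^sup>2) \<partial>circle_measure) =
        (\<integral>\<^sup>+z. liminf (\<lambda>m. ennreal ((cmod (x n z - x (r m) z))\<^sup>2)) \<partial>circle_measure)"
    proof (rule nn_integral_cong_AE)
      show "AE z in circle_measure. ennreal ((cmod (x n z - l z))\<^sup>2) =
          liminf (\<lambda>m. ennreal ((cmod (x n z - x (r m) z))\<^sup>2))"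
        using lim
      proof eventually_elim
        case (elim z)
        have "(\<lambda>m. ennreal ((cmod (x n z - x (r m) z))\<^sup>2)) \<longlonglongrightarrow> ennreal ((cmod (x n z - l z))\<^sup>2)"
          by (intro tendsto_ennrealI tendsto_intros elim)
        then show ?case by (intro lim_imp_Liminf[symmetric]) auto
      qed
    qed
    also have "\<dots> \<le> liminf (\<lambda>m. \<integral>\<^sup>+z. ennreal ((cmod (x n z - x (r m) z))\<^sup>2) \<partial>circle_measure)"
      by (rule nn_integral_liminf) measurable
    also have "\<dots> = liminf (\<lambda>m. ennreal (sqnorm (X n - X (r m))))"
      unfolding x_def nn_integral_diff_eq_sqnorm ..
    also have "\<dots> \<le> ennreal e"
    proof (rule Liminf_le)
      \<comment> \<open>A strictly increasing index sequence satisfies \<open>m \<le> r m\<close>,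
        so it stays in the Cauchy tail.\<close>
      have "r m \<ge> N" if "m \<ge> N" for m
        using that seq_suble[OF r(1), of m] by linarith
      then show "\<forall>\<^sub>F m in sequentially. ennreal (sqnorm (X n - X (r m))) \<le> ennreal e"
        using N \<open>n \<ge> N\<close> by (auto simp: eventually_sequentially intro!: exI[of _ N] ennreal_leI intro: less_imp_le)
    qed simp
    finally show ?thesis .
  qed
  obtain N1 where N1: "\<forall>i\<ge>N1. \<forall>j\<ge>N1. sqnorm (X i - X j) < 1" using assms[of 1] by auto
  have "square_integrable (\<lambda>z. x N1 z - l z)"
    unfolding square_integrable_def
  proof
    show "integrable circle_measure (\<lambda>z. (cmod (x N1 z - l z))\<^sup>2)"
      using Fatou[OF N1 order_refl]
      by (intro integrableI_bounded) (auto simp: le_less_trans)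
  qed measurable
  \<comment> \<open>Here \<open>l\<close> is recovered as \<open>x N1\<close> minus the difference
    \<open>x N1 - l\<close>.\<close>
  from square_integrable_add[OF square_integrable_scale[OF this, of "-1"], of "x N1"]
  have l: "square_integrable l" by (simp add: x_def)
  have "sqnorm (X n - abs_L2 l) \<le> e" if N: "\<forall>i\<ge>N. \<forall>j\<ge>N. sqnorm (X i - X j) < e" and "n \<ge> N" for n N e
  proof -
    have "ennreal (sqnorm (X n - abs_L2 l)) = (\<integral>\<^sup>+z. ennreal ((cmod (x n z - l z))\<^sup>2) \<partial>circle_measure)"
      unfolding nn_integral_diff_eq_sqnorm[symmetric]
      using rep_abs_L2[OF l] by (intro nn_integral_cong_AE) (auto simp: x_def)
    also have "\<dots> \<le> ennreal e" by (rule Fatou[OF that])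
    finally have "ennreal (sqnorm (X n - abs_L2 l)) \<le> ennreal e" .
    moreover have "0 \<le> e"
      using N \<open>n \<ge> N\<close> sqnorm_nonneg[of "X n - X n"] by (meson le_less_trans less_imp_le)
    ultimately show ?thesis by simp
  qed
  note le = this
  have "(\<lambda>n. sqnorm (X n - abs_L2 l)) \<longlonglongrightarrow> 0"
  proof (rule LIMSEQ_I)
    fix e :: real assume "e > 0"
    \<comment> \<open>Half of \<open>e\<close> is taken because the bound \<open>le\<close> is not
      strict.\<close>
    then obtain N where N: "\<forall>i\<ge>N. \<forall>j\<ge>N. sqnorm (X i - X j) < e / 2"
      using assms[of "e / 2"] by auto
    then show "\<exists>N. \<forall>n\<ge>N. norm (sqnorm (X n - abs_L2 l) - 0) < e"
      using le[OF N] \<open>e > 0\<close> by (intro exI[of _ N]) force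
  qed
  then show ?thesis by (rule that)
qed

section \<open>One-sided Fourier sums and the analytic part of a function\<close>

definition partial_sum :: "L2 \<Rightarrow> nat \<Rightarrow> L2" where
  "partial_sum f n = (\<Sum>k<n. cinner f (z_powi (int k)) *\<^sub>C z_powi (int k))"

lemma cinner_partial_sum_z_powi:
  "cinner (partial_sum f n) (z_powi j) = (if 0 \<le> j \<and> j < int n then cinner f (z_powi j) else 0)"
proof -
  have "cinner (partial_sum f n) (z_powi j) = (\<Sum>k<n. if int k = j then cinner f (z_powi j) else 0)"
    unfolding partial_sum_def cinner_sum_left cinner_scaleC_left cinner_z_powi
    by (intro sum.cong) auto
  also have "\<dots> = (if 0 \<le> j \<and> j < int n then cinner f (z_powi j) else 0)"
  proof (cases "0 \<le> j")
    case True
    then have "(\<Sum>k<n. if int k = j then cinner f (z_powi j) else 0) =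
        (\<Sum>k<n. if k = nat j then cinner f (z_powi j) else 0)"
      by (intro sum.cong) auto
    also have "\<dots> = (if nat j < n then cinner f (z_powi j) else 0)"
      by simp
    finally show ?thesis using True by auto
  qed (auto intro!: sum.neutral)
  finally show ?thesis .
qed

lemma cinner_partial_sum_right:
  "cinner g (partial_sum f n) = (\<Sum>k<n. cnj (cinner f (z_powi (int k))) * cinner g (z_powi (int k)))"
  by (simp add: partial_sum_def cinner_sum_right cinner_scaleC_right)

lemma cinner_partial_sum_partial_sum:
  "cinner (partial_sum f m) (partial_sum f n) =
     of_real (\<Sum>k<min m n. (cmod (cinner f (z_powi (int k))))\<^sup>2)"
proof -
  have "cinner (partial_sum f m) (partial_sum f n) =
      (\<Sum>k<n. if k < m then of_real ((cmod (cinner f (z_powi (int k))))\<^sup>2) else 0)"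
    unfolding cinner_partial_sum_right cinner_partial_sum_z_powi
    by (intro sum.cong) (auto simp: complex_norm_square[symmetric] mult.commute)
  also have "\<dots> = (\<Sum>k\<in>{..<n} \<inter> {k. k < m}. of_real ((cmod (cinner f (z_powi (int k))))\<^sup>2))"
    by (subst sum.inter_restrict) (auto intro!: sum.cong)
  also have "{..<n} \<inter> {k. k < m} = {..<min m n}" by auto
  finally show ?thesis by simp
qed

lemma sqnorm_partial_sum_diff:
  assumes "m \<le> n"
  shows "sqnorm (partial_sum f n - partial_sum f m) =
    (\<Sum>k<n. (cmod (cinner f (z_powi (int k))))\<^sup>2) - (\<Sum>k<m. (cmod (cinner f (z_powi (int k))))\<^sup>2)"
  using assms
  by (simp add: sqnorm_def cinner_diff_left cinner_diff_right cinner_partial_sum_partial_sum min_def)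

text \<open>By orthonormality \<open>sqnorm (f - partial_sum f n)\<close> equals
  \<open>sqnorm f\<close> minus the sum, and it is nonnegative.\<close>

lemma Bessel: "(\<Sum>k<n. (cmod (cinner f (z_powi (int k))))\<^sup>2) \<le> sqnorm f"
proof -
  let ?s = "\<Sum>k<n. (cmod (cinner f (z_powi (int k))))\<^sup>2"
  have 1: "cinner f (partial_sum f n) = of_real ?s"
    by (simp add: cinner_partial_sum_right complex_norm_square[symmetric] mult.commute
        del: of_real_power)
  have 2: "cinner (partial_sum f n) f = of_real ?s"
    by (subst cinner_commute) (simp add: 1 del: of_real_sum)
  have "0 \<le> sqnorm (f - partial_sum f n)" by simp
  also have "\<dots> = sqnorm f - ?s"
    by (simp add: sqnorm_def cinner_diff_left cinner_diff_right 1 2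
        cinner_partial_sum_partial_sum del: of_real_sum)
  finally show ?thesis by simp
qed

text \<open>Riesz-Fischer: Bessel's inequality makes the squared coefficients summable, so the
  partial sums are Cauchy and completeness gives a limit. Summing over nonnegative indices only
  makes this limit the analytic part of \<open>f\<close>.\<close>

lemma partial_sum_converges:
  obtains h where "(\<lambda>n. sqnorm (partial_sum f n - h)) \<longlonglongrightarrow> 0"
    "\<And>j. cinner h (z_powi j) = (if 0 \<le> j then cinner f (z_powi j) else 0)"
proof -
  let ?a = "\<lambda>k. (cmod (cinner f (z_powi (int k))))\<^sup>2"
  have "summable ?a"
    by (rule bounded_imp_summable[where B="sqnorm f"])
      (use Bessel[of f "Suc _"] in \<open>auto simp: lessThan_Suc_atMost\<close>)
  then have Cauchy: "Cauchy (\<lambda>n. \<Sum>k<n. ?a k)"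
    by (simp add: summable_iff_convergent Cauchy_convergent_iff)
  have "\<exists>N. \<forall>m\<ge>N. \<forall>n\<ge>N. sqnorm (partial_sum f m - partial_sum f n) < e" if e: "e > 0" for e
  proof -
    obtain N where N: "\<And>m n. m \<ge> N \<Longrightarrow> n \<ge> N \<Longrightarrow> \<bar>(\<Sum>k<m. ?a k) - (\<Sum>k<n. ?a k)\<bar> < e"
      using CauchyD[OF Cauchy e] by auto
    have "sqnorm (partial_sum f m - partial_sum f n) < e" if "m \<ge> N" "n \<ge> N" for m n
      using N[OF that] sqnorm_partial_sum_diff[of m n f] sqnorm_partial_sum_diff[of n m f]
        sqnorm_minus_commute[of "partial_sum f m" "partial_sum f n"]
      by (cases "m \<le> n") auto
    then show ?thesis by blast
  qed
  then obtain h where h: "(\<lambda>n. sqnorm (partial_sum f n - h)) \<longlonglongrightarrow> 0"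
    using L2_complete[of "partial_sum f"] by metis
  have "cinner h (z_powi j) = (if 0 \<le> j then cinner f (z_powi j) else 0)" for j
  proof (rule LIMSEQ_unique[OF tendsto_cinner_left[OF h]])
    \<comment> \<open>For fixed \<open>j\<close> the coefficient no longer changes once
      \<open>n > nat j\<close>; for negative \<open>j\<close> it is always 0.\<close>
    have "cinner (partial_sum f n) (z_powi j) = (if 0 \<le> j then cinner f (z_powi j) else 0)"
      if "n > nat j" for n
      using that by (auto simp: cinner_partial_sum_z_powi)
    then show "(\<lambda>n. cinner (partial_sum f n) (z_powi j)) \<longlonglongrightarrow>
        (if 0 \<le> j then cinner f (z_powi j) else 0)"
      by (intro tendsto_eventually) (auto simp: eventually_at_top_dense intro!: exI[of _ "nat j"])
  qed
  with h show ?thesis by (rule that)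
qed

text \<open>By totality an analytic \<open>f\<close> is the limit of its own partial sums, each of
  which is orthogonal to \<open>g\<close>.\<close>

lemma H2_orth_H2_0_bar:
  assumes "f \<in> H2" "g \<in> H2_0_bar"
  shows "cinner f g = 0"
proof -
  obtain h where h: "(\<lambda>n. sqnorm (partial_sum f n - h)) \<longlonglongrightarrow> 0"
    "\<And>j. cinner h (z_powi j) = (if 0 \<le> j then cinner f (z_powi j) else 0)"
    using partial_sum_converges[of f] by blast
  have "f - h = 0"
    using assms(1) by (intro L2_eq_zeroI) (auto simp: cinner_diff_left h H2_iff)
  then have "h = f" by simp
  have "cinner (z_powi (int k)) g = 0" for k
    using assms(2) cinner_eq_0_commute[of g "z_powi (int k)"] by (auto simp: H2_0_bar_iff)
  then have "cinner (partial_sum f n) g = 0" for n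
    by (simp add: partial_sum_def cinner_sum_left cinner_scaleC_left)
  then show ?thesis
    using tendsto_cinner_left[OF h(1), of g] \<open>h = f\<close> by (simp add: LIMSEQ_const_iff)
qed

lemma L2_decomposition:
  obtains h g where "h \<in> H2" "g \<in> H2_0_bar" "f = h + g"
proof -
  obtain h where "\<And>j. cinner h (z_powi j) = (if 0 \<le> j then cinner f (z_powi j) else 0)"
    using partial_sum_converges[of f] by metis
  then have "h \<in> H2" "f - h \<in> H2_0_bar"
    by (auto simp: H2_iff H2_0_bar_iff cinner_diff_left)
  then show ?thesis by (intro that[of h "f - h"]) auto
qed

section \<open>Multiplication by unimodular functions and boundary values\<close>

text \<open>The modulus is 1 at every point of the circle, not just almost everywhere, so that the
  pointwise bound for products of square integrable functions applies.\<close>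

definition unimodular :: "(complex \<Rightarrow> complex) \<Rightarrow> bool" where
  "unimodular \<phi> \<longleftrightarrow> \<phi> \<in> borel_measurable circle_measure \<and> (\<forall>z. cmod z = 1 \<longrightarrow> cmod (\<phi> z) = 1)"

lemma square_integrable_unimodular_mult:
  "unimodular \<phi> \<Longrightarrow> square_integrable f \<Longrightarrow> square_integrable (\<lambda>z. \<phi> z * f z)"
  by (rule square_integrable_bounded_mult[where B=1]) (auto simp: unimodular_def)

lemma unimodular_cnj: "unimodular \<phi> \<Longrightarrow> unimodular (\<lambda>z. cnj (\<phi> z))"
proof -
  have [measurable]: "cnj \<in> borel_measurable borel"
    by (intro borel_measurable_continuous_onI continuous_intros)
  show "unimodular \<phi> \<Longrightarrow> unimodular (\<lambda>z. cnj (\<phi> z))"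
    by (auto simp: unimodular_def)
qed

text \<open>The guard only serves to make the operator total; it is meant for unimodular symbols.\<close>

lift_definition mult_L2 :: "(complex \<Rightarrow> complex) \<Rightarrow> L2 \<Rightarrow> L2"
  is "\<lambda>\<phi> f. if unimodular \<phi> then \<lambda>z. \<phi> z * f z else f"
  by (auto simp: L2_rel_def square_integrable_unimodular_mult)

lemma mult_L2_add: "mult_L2 \<phi> (f + g) = mult_L2 \<phi> f + mult_L2 \<phi> g"
  by transfer (auto simp: L2_rel_def square_integrable_add square_integrable_unimodular_mult
      algebra_simps intro!: square_integrable_unimodular_mult)

lemma mult_L2_scaleC: "mult_L2 \<phi> (a *\<^sub>C f) = a *\<^sub>C mult_L2 \<phi> f"
  by transfer (auto simp: L2_rel_def square_integrable_scale square_integrable_unimodular_mult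
      mult.left_commute[of a])

lemma mult_L2_mult_z: "mult_L2 \<phi> (mult_z f) = mult_z (mult_L2 \<phi> f)"
  by transfer (auto simp: L2_rel_def square_integrable_id_mult square_integrable_unimodular_mult
      mult.left_commute)

lemma mult_L2_cnj_cancel:
  assumes "unimodular \<phi>"
  shows "mult_L2 \<phi> (mult_L2 (\<lambda>z. cnj (\<phi> z)) f) = f"
  using assms
proof transfer
  fix \<phi> f assume \<phi>: "unimodular \<phi>" and f: "L2_rel f f"
  have "\<phi> z * (cnj (\<phi> z) * f z) = f z" if "cmod z = 1" for z
    using \<phi> that complex_norm_square[of "\<phi> z"] by (simp add: unimodular_def mult.assoc[symmetric])
  then have "AE z in circle_measure. \<phi> z * (cnj (\<phi> z) * f z) = f z" by (intro AE_I2) simp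
  moreover have "square_integrable (\<lambda>z. \<phi> z * (cnj (\<phi> z) * f z))"
    using f by (intro square_integrable_unimodular_mult unimodular_cnj \<phi>) (simp add: L2_rel_def)
  ultimately show "L2_rel (if unimodular \<phi> then \<lambda>z. \<phi> z * (if unimodular (\<lambda>z. cnj (\<phi> z))
      then \<lambda>z. cnj (\<phi> z) * f z else f) z
      else if unimodular (\<lambda>z. cnj (\<phi> z)) then \<lambda>z. cnj (\<phi> z) * f z else f) f"
    using \<phi> f by (simp add: L2_rel_def unimodular_cnj)
qed

lemma cinner_mult_L2_left:
  assumes "unimodular \<phi>"
  shows "cinner (mult_L2 \<phi> f) g = cinner f (mult_L2 (\<lambda>z. cnj (\<phi> z)) g)"
  using assms
  by transfer (auto simp: unimodular_cnj mult_ac intro!: Bochner_Integration.integral_cong)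

lemma cinner_mult_L2_mult_L2:
  assumes "unimodular \<phi>"
  shows "cinner (mult_L2 \<phi> f) (mult_L2 \<phi> g) = cinner f g"
proof -
  have "mult_L2 (\<lambda>z. cnj (\<phi> z)) (mult_L2 \<phi> g) = g"
    using mult_L2_cnj_cancel[OF unimodular_cnj[OF assms], of g] by simp
  then show ?thesis by (simp add: cinner_mult_L2_left[OF assms])
qed

text \<open>Links multiplication of classes to the relation between representatives by which
  \<open>mult_H2\<close> is defined.\<close>

lemma eq_mult_L2_iff:
  assumes "unimodular \<phi>"
  shows "f = mult_L2 \<phi> h \<longleftrightarrow> (AE z in circle_measure. rep_L2 f z = \<phi> z * rep_L2 h z)"
proof -
  have "mult_L2 \<phi> h = abs_L2 (\<lambda>z. \<phi> z * rep_L2 h z)"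
    using assms by (simp add: mult_L2_def)
  moreover have "AE z in circle_measure. rep_L2 (abs_L2 (\<lambda>z. \<phi> z * rep_L2 h z)) z = \<phi> z * rep_L2 h z"
    by (intro rep_abs_L2 square_integrable_unimodular_mult assms square_integrable_rep_L2)
  ultimately have "AE z in circle_measure. rep_L2 (mult_L2 \<phi> h) z = \<phi> z * rep_L2 h z" by simp
  note mult = this
  show ?thesis
  proof
    assume "AE z in circle_measure. rep_L2 f z = \<phi> z * rep_L2 h z"
    with mult have "AE z in circle_measure. rep_L2 f z = rep_L2 (mult_L2 \<phi> h) z"
      by eventually_elim simp
    then show "f = mult_L2 \<phi> h" by (simp add: L2_eq_iff_AE)
  qed (use mult in simp)
qed

text \<open>Replaces the radial limit, controlled only almost everywhere, by a measurable function
  of modulus 1 everywhere. The integrals are its Fourier coefficients of index \<open>- m\<close>;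
  the bound of \<open>u\<close> on the disk is the dominating function.\<close>

lemma inner_function_boundary:
  assumes "inner_function u"
  obtains \<phi> where "unimodular \<phi>" "AE z in circle_measure. radial_limit u z = \<phi> z"
    "\<And>m::nat. (LINT z|circle_measure. \<phi> z * z ^ m) = (if m = 0 then u 0 else 0)"
proof -
  have hol: "u holomorphic_on ball 0 1" and bdd: "bounded (u ` ball 0 1)"
    and lim: "AE z in circle_measure. ((\<lambda>r::real. u (of_real r * z)) \<longlongrightarrow> radial_limit u z) (at_left 1)
      \<and> cmod (radial_limit u z) = 1"
    using assms by (auto simp: inner_function_def)
  interpret prob_space circle_measure by (rule prob_space_circle_measure)
  obtain B where B: "\<And>z. cmod z < 1 \<Longrightarrow> cmod (u z) \<le> B"
    using bdd unfolding bounded_iff by (metis dist_0_norm image_eqI mem_ball)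
  \<comment> \<open>The summand 2 keeps \<open>r 0 = 1 / 2\<close> positive, as the mean value
    property demands.\<close>
  define r where "r n = 1 - 1 / (real n + 2)" for n
  have r: "0 < r n" "r n < 1" for n by (auto simp: r_def)
  have "r \<longlonglongrightarrow> 1" unfolding r_def by real_asymp
  then have r_lim: "filterlim r (at_left 1) sequentially"
    using r by (intro filterlim_at_withinI) (auto simp: less_imp_neq)
  define U where "U n z = u (of_real (r n) * z)" for n z
  have U_meas [measurable]: "U n \<in> borel_measurable circle_measure" for n
  proof -
    have "U n \<in> borel_measurable (restrict_space borel (sphere 0 1))"
      unfolding U_def using r[of n]
      by (intro borel_measurable_continuous_on_restrict
          continuous_on_compose2[OF holomorphic_on_imp_continuous_on[OF hol]] continuous_intros)
        (auto simp: norm_mult)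
    then show ?thesis by (simp add: circle_measure_def)
  qed
  \<comment> \<open>A limit along a sequence keeps \<open>\<phi>\<close> measurable. The default
    value 1 covers the points where that limit fails to have modulus 1.\<close>
  define \<phi> where "\<phi> z = (let w = lim (\<lambda>n. U n z) in if cmod w = 1 then w else 1)" for z
  have [measurable]: "\<phi> \<in> borel_measurable circle_measure"
    unfolding \<phi>_def Let_def by measurable
  have lims: "AE z in circle_measure. (\<lambda>n. U n z) \<longlonglongrightarrow> \<phi> z \<and> radial_limit u z = \<phi> z"
    using lim
  proof eventually_elim
    case (elim z)
    then have "(\<lambda>n. U n z) \<longlonglongrightarrow> radial_limit u z"
      unfolding U_def by (intro filterlim_compose[OF conjunct1[OF elim] r_lim])
    moreover from this have "\<phi> z = radial_limit u z"
      using elim by (simp add: \<phi>_def limI)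
    ultimately show ?case by simp
  qed
  have "(LINT z|circle_measure. \<phi> z * z ^ m) = (if m = 0 then u 0 else 0)" for m :: nat
  proof -
    have [measurable]: "(\<lambda>z::complex. z ^ m) \<in> borel_measurable circle_measure"
      by (intro borel_measurable_circle_continuous continuous_intros)
    have 1: "(LINT z|circle_measure. U n z * z ^ m) = (if m = 0 then u 0 else 0)" for n
    proof -
      \<comment> \<open>The integrand carries the positive factor \<open>r n ^ m\<close>, which
        cancels; the value at the centre vanishes unless \<open>m = 0\<close>.\<close>
      have "(LINT z|circle_measure. (\<lambda>w. u w * w ^ m) (of_real (r n) * z)) = u 0 * 0 ^ m"
        using circle_mean_value[of "\<lambda>w. u w * w ^ m" "r n"] hol r[of n]
        by (simp add: holomorphic_intros)
      moreover have "(LINT z|circle_measure. (\<lambda>w. u w * w ^ m) (of_real (r n) * z)) =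
          (LINT z|circle_measure. of_real (r n) ^ m * (U n z * z ^ m))"
        by (intro Bochner_Integration.integral_cong) (auto simp: U_def power_mult_distrib)
      ultimately show ?thesis
        using r[of n] by (cases "m = 0") (auto simp: power_0_left)
    qed
    have "(\<lambda>n. LINT z|circle_measure. U n z * z ^ m) \<longlonglongrightarrow> (LINT z|circle_measure. \<phi> z * z ^ m)"
    proof (rule integral_dominated_convergence[where w="\<lambda>_. B"])
      show "AE z in circle_measure. (\<lambda>n. U n z * z ^ m) \<longlonglongrightarrow> \<phi> z * z ^ m"
        using lims by eventually_elim (intro tendsto_intros, blast)
      show "AE z in circle_measure. norm (U n z * z ^ m) \<le> B" for n
        using r[of n] by (intro AE_I2) (auto simp: norm_mult norm_power U_def intro!: B)
    qed auto
    then show ?thesis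
      using LIMSEQ_unique[OF _ tendsto_const] by (simp add: 1 LIMSEQ_const_iff)
  qed
  moreover have "unimodular \<phi>"
    by (auto simp: unimodular_def \<phi>_def Let_def)
  moreover have "AE z in circle_measure. radial_limit u z = \<phi> z"
    using lims by eventually_elim simp
  ultimately show ?thesis by (rule that[rotated 2])
qed

section \<open>The dual of the compressed shift\<close>

lemma H2_add: "f \<in> H2 \<Longrightarrow> g \<in> H2 \<Longrightarrow> f + g \<in> H2"
  by (simp add: H2_iff cinner_add_left)

lemma H2_diff: "f \<in> H2 \<Longrightarrow> g \<in> H2 \<Longrightarrow> f - g \<in> H2"
  by (simp add: H2_iff cinner_diff_left)

lemma H2_scaleC: "f \<in> H2 \<Longrightarrow> a *\<^sub>C f \<in> H2"
  by (simp add: H2_iff cinner_scaleC_left)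

lemma H2_0_bar_add: "f \<in> H2_0_bar \<Longrightarrow> g \<in> H2_0_bar \<Longrightarrow> f + g \<in> H2_0_bar"
  by (simp add: H2_0_bar_iff cinner_add_left)

lemma H2_0_bar_diff: "f \<in> H2_0_bar \<Longrightarrow> g \<in> H2_0_bar \<Longrightarrow> f - g \<in> H2_0_bar"
  by (simp add: H2_0_bar_iff cinner_diff_left)

lemma H2_0_bar_scaleC: "f \<in> H2_0_bar \<Longrightarrow> a *\<^sub>C f \<in> H2_0_bar"
  by (simp add: H2_0_bar_iff cinner_scaleC_left)

lemma one_in_H2: "one_L2 \<in> H2"
  by (simp add: H2_iff z_powi_0[symmetric] cinner_z_powi)

lemma mult_z_in_H2: "f \<in> H2 \<Longrightarrow> mult_z f \<in> H2"
  by (simp add: H2_iff cinner_mult_z_z_powi)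

lemma mult_z_add: "mult_z (f + g) = mult_z f + mult_z g"
  by transfer (simp add: L2_rel_def square_integrable_id_mult square_integrable_add distrib_left)

lemma orth_compl_add: "x \<in> orth_compl M \<Longrightarrow> y \<in> orth_compl M \<Longrightarrow> x + y \<in> orth_compl M"
  by (simp add: orth_compl_def cinner_add_left)

lemma orth_compl_scaleC: "x \<in> orth_compl M \<Longrightarrow> a *\<^sub>C x \<in> orth_compl M"
  by (simp add: orth_compl_def cinner_scaleC_left)

lemma orth_compl_diff: "x \<in> orth_compl M \<Longrightarrow> y \<in> orth_compl M \<Longrightarrow> x - y \<in> orth_compl M"
  by (simp add: orth_compl_def cinner_diff_left)

text \<open>Multiplication by z raises indices by one, so the only nonnegative index that can
  survive is 0, with the coefficient of \<open>g\<close> at -1.\<close>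

lemma mult_z_minus_constant_in_H2_0_bar:
  assumes "g \<in> H2_0_bar"
  shows "mult_z g - cinner g zbar_L2 *\<^sub>C one_L2 \<in> H2_0_bar"
  unfolding H2_0_bar_iff z_powi_0[symmetric] z_powi_m1[symmetric]
proof (intro allI impI)
  fix j :: int assume "j \<ge> 0"
  then show "cinner (mult_z g - cinner g (z_powi (-1)) *\<^sub>C z_powi 0) (z_powi j) = 0"
    using assms by (cases "j = 0")
      (simp_all add: H2_0_bar_iff cinner_diff_left cinner_scaleC_left cinner_z_powi cinner_mult_z_z_powi)
qed

lemma Q_op_eq:
  assumes "g \<in> H2_0_bar"
  shows "Q_op g = mult_z g - cinner g zbar_L2 *\<^sub>C one_L2"
  unfolding Q_op_def P_minus_def
  by (rule orth_proj_eqI[OF H2_0_bar_diff mult_z_minus_constant_in_H2_0_bar[OF assms]])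
    (auto simp: orth_compl_def intro: H2_orth_H2_0_bar H2_scaleC one_in_H2)

lemma mult_H2_eq_image:
  assumes "unimodular \<phi>" "AE z in circle_measure. radial_limit u z = \<phi> z"
  shows "mult_H2 u = mult_L2 \<phi> ` H2"
proof -
  have "(AE z in circle_measure. rep_L2 f z = radial_limit u z * rep_L2 h z) \<longleftrightarrow> f = mult_L2 \<phi> h" for f h
    unfolding eq_mult_L2_iff[OF assms(1)]
  proof
    assume "AE z in circle_measure. rep_L2 f z = radial_limit u z * rep_L2 h z"
    with assms(2) show "AE z in circle_measure. rep_L2 f z = \<phi> z * rep_L2 h z"
      by eventually_elim simp
  next
    assume "AE z in circle_measure. rep_L2 f z = \<phi> z * rep_L2 h z"
    with assms(2) show "AE z in circle_measure. rep_L2 f z = radial_limit u z * rep_L2 h z"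
      by eventually_elim simp
  qed
  then show ?thesis by (auto simp: mult_H2_def)
qed

text \<open>Collects the properties of an inner function on which the operator theory rests:
  \<open>coeff\<close> says that \<open>\<phi>\<close> is analytic with constant coefficient
  \<open>u 0\<close>.\<close>

locale boundary_symbol =
  fixes u :: "complex \<Rightarrow> complex" and \<phi> :: "complex \<Rightarrow> complex"
  assumes unimodular: "unimodular \<phi>"
    and boundary: "AE z in circle_measure. radial_limit u z = \<phi> z"
    and coeff: "\<And>m::nat. (LINT z|circle_measure. \<phi> z * z ^ m) = (if m = 0 then u 0 else 0)"
begin

abbreviation "M \<equiv> mult_L2 \<phi>"

text \<open>The inner product is the coefficient of \<open>\<phi>\<close> of index
  \<open>n - k \<le> 0\<close>.\<close>

lemma cinner_M_z_powi_z_powi: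
  assumes "n \<le> k"
  shows "cinner (M (z_powi k)) (z_powi n) = (if n = k then u 0 else 0)"
proof -
  have "cinner (M (z_powi k)) (z_powi n) = (LINT z|circle_measure. \<phi> z * z ^ nat (k - n))"
    using unimodular assms
  proof transfer
    fix \<phi> :: "complex \<Rightarrow> complex" and k n :: int assume "unimodular \<phi>" "n \<le> k"
    have "\<phi> z * z powi k * cnj (z powi n) = \<phi> z * z ^ nat (k - n)" if "cmod z = 1" for z
    proof -
      have "z powi k * z powi (- n) = z powi (k - n)"
        using that power_int_add[of z k "- n"] by force
      also have "\<dots> = z ^ nat (k - n)"
        using power_int_of_nat[of z "nat (k - n)"] \<open>n \<le> k\<close> by simp
      finally show ?thesis using that by (simp add: cnj_powi_circle)
    qed
    then show "(LINT z|circle_measure. (if unimodular \<phi> then \<lambda>z. \<phi> z * z powi k else (\<lambda>z. z powi k)) z * cnj (z powi n)) =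
        (LINT z|circle_measure. \<phi> z * z ^ nat (k - n))"
      using \<open>unimodular \<phi>\<close> by (intro Bochner_Integration.integral_cong) auto
  qed
  then show ?thesis using assms by (auto simp: coeff)
qed

text \<open>The multiplier is moved to the other side. The conjugate of \<open>\<phi>\<close> times
  \<open>z_powi n\<close> is conjugate-analytic up to the constant \<open>a\<close>, and
  \<open>h\<close> is orthogonal to the conjugate-analytic part.\<close>

lemma cinner_M_z_powi:
  assumes "h \<in> H2" "n \<le> 0"
  shows "cinner (M h) (z_powi n) = (if n = 0 then u 0 * cinner h one_L2 else 0)"
proof -
  let ?e = "mult_L2 (\<lambda>z. cnj (\<phi> z)) (z_powi n)"
  define a where "a = (if n = 0 then cnj (u 0) else 0)"
  have "cinner ?e (z_powi j) = (if j = n then cnj (u 0) else 0)" if "j \<ge> 0" for j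
  proof -
    have "cinner ?e (z_powi j) = cnj (cinner (M (z_powi j)) (z_powi n))"
      by (subst cinner_commute) (simp add: cinner_mult_L2_left[OF unimodular])
    then show ?thesis using cinner_M_z_powi_z_powi[of n j] that assms(2) by auto
  qed
  then have "?e - a *\<^sub>C one_L2 \<in> H2_0_bar"
    using assms(2) by (auto simp: H2_0_bar_iff cinner_diff_left cinner_scaleC_left
        z_powi_0[symmetric] cinner_z_powi a_def)
  then have "cinner h (?e - a *\<^sub>C one_L2) = 0"
    by (rule H2_orth_H2_0_bar[OF assms(1)])
  then show ?thesis
    by (simp add: cinner_mult_L2_left[OF unimodular] cinner_diff_right cinner_scaleC_right a_def)
qed

lemma M_in_H2: "h \<in> H2 \<Longrightarrow> M h \<in> H2"
  using cinner_M_z_powi by (simp add: H2_iff)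

lemma model_space_eq: "model_space u = H2 \<inter> orth_compl (M ` H2)"
  by (simp add: model_space_def mult_H2_eq_image[OF unimodular boundary])

lemma model_space_diff: "x \<in> model_space u \<Longrightarrow> y \<in> model_space u \<Longrightarrow> x - y \<in> model_space u"
  by (simp add: model_space_eq H2_diff orth_compl_diff)

lemma model_space_scaleC: "x \<in> model_space u \<Longrightarrow> a *\<^sub>C x \<in> model_space u"
  by (simp add: model_space_eq H2_scaleC orth_compl_scaleC)

text \<open>This is the reproducing kernel of the model space at the origin.\<close>

lemma kernel_at_0_in_model_space: "one_L2 - cnj (u 0) *\<^sub>C M one_L2 \<in> model_space u"
proof -
  have "cinner (one_L2 - cnj (u 0) *\<^sub>C M one_L2) (M h) = 0" if h: "h \<in> H2" for h
  proof -
    have "cinner (M h) one_L2 = u 0 * cinner h one_L2"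
      using cinner_M_z_powi[OF h, of 0] by (simp add: z_powi_0)
    then have "cinner one_L2 (M h) = cnj (u 0) * cinner one_L2 h"
      by (metis cinner_commute complex_cnj_mult)
    then show ?thesis
      by (simp add: cinner_diff_left cinner_scaleC_left cinner_mult_L2_mult_L2[OF unimodular])
  qed
  then show ?thesis
    by (auto simp: model_space_eq orth_compl_def intro: H2_diff H2_scaleC M_in_H2 one_in_H2)
qed

section \<open>The unitary map onto the complement of the model space\<close>

definition V :: "L2 \<times> L2 \<Rightarrow> L2" where
  "V = (\<lambda>(h, g). M h + g)"

lemma V_in_orth_compl:
  assumes "h \<in> H2" "g \<in> H2_0_bar"
  shows "V (h, g) \<in> orth_compl (model_space u)"
proof -
  have "cinner (M h) k = 0" "cinner g k = 0" if "k \<in> model_space u" for k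
    using that assms H2_orth_H2_0_bar[of k g] cinner_eq_0_commute[of _ k]
    by (auto simp: model_space_eq orth_compl_def)
  then show ?thesis by (simp add: V_def orth_compl_def cinner_add_left)
qed

lemma orth_compl_model_space_eq:
  "orth_compl (model_space u) = V ` (H2 \<times> H2_0_bar)"
proof (intro equalityI subsetI)
  fix f assume f: "f \<in> orth_compl (model_space u)"
  obtain h g where hg: "h \<in> H2" "g \<in> H2_0_bar" "f = h + g" by (rule L2_decomposition)
  let ?N = "mult_L2 (\<lambda>z. cnj (\<phi> z))"
  obtain h1 g1 where hg1: "h1 \<in> H2" "g1 \<in> H2_0_bar" "?N h = h1 + g1" by (rule L2_decomposition)
  have "h = M (?N h)" by (simp add: mult_L2_cnj_cancel[OF unimodular])
  then have h: "h = M h1 + M g1" by (simp add: hg1 mult_L2_add)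
  have "M g1 = h - M h1" using h by simp
  then have "M g1 \<in> H2" using hg(1) hg1(1) by (simp add: H2_diff M_in_H2)
  moreover have "cinner (M g1) (M h') = 0" if "h' \<in> H2" for h'
    using that hg1(2) H2_orth_H2_0_bar[of h' g1] cinner_eq_0_commute[of g1 h']
    by (simp add: cinner_mult_L2_mult_L2[OF unimodular])
  ultimately have k: "M g1 \<in> model_space u" by (auto simp: model_space_eq orth_compl_def)
  have "f - V (h1, g) \<in> orth_compl (model_space u)"
    using f V_in_orth_compl hg hg1 by (intro orth_compl_diff) auto
  moreover have "f - V (h1, g) = M g1" by (simp add: V_def hg(3) h)
  ultimately have "M g1 = 0"
    using k by (auto simp: orth_compl_def cinner_eq_zero_iff)
  then have "f = V (h1, g)" by (simp add: V_def hg(3) h)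
  then show "f \<in> V ` (H2 \<times> H2_0_bar)" using hg hg1 by auto
qed (auto simp: V_in_orth_compl)

lemma cinner_V:
  assumes "h \<in> H2" "g \<in> H2_0_bar" "h' \<in> H2" "g' \<in> H2_0_bar"
  shows "cinner (V (h, g)) (V (h', g')) = cinner h h' + cinner g g'"
proof -
  have "cinner (M h) g' = 0" "cinner g (M h') = 0"
    using assms M_in_H2 H2_orth_H2_0_bar cinner_eq_0_commute by blast+
  then show ?thesis
    by (simp add: V_def cinner_add_left cinner_add_right cinner_mult_L2_mult_L2[OF unimodular])
qed

text \<open>Multiplying \<open>V (h, g)\<close> by z yields \<open>V (mult_z h, Q_op g)\<close> plus
  the constant \<open>?a\<close>. That constant is \<open>?k\<close>, a multiple of the kernel
  function, plus a multiple of \<open>M one_L2\<close>, which is absorbed into the first argument of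
  \<open>V\<close>.\<close>

lemma dual_compressed_shift_V:
  assumes "h \<in> H2" "g \<in> H2_0_bar"
  shows "dual_compressed_shift u (V (h, g)) =
    V (mult_z h + cnj (u 0) *\<^sub>C cinner g zbar_L2 *\<^sub>C one_L2, Q_op g)"
    (is "_ = ?R")
proof -
  let ?a = "cinner g zbar_L2"
  let ?k = "?a *\<^sub>C (one_L2 - cnj (u 0) *\<^sub>C M one_L2)"
  have k: "?k \<in> model_space u"
    by (intro model_space_scaleC kernel_at_0_in_model_space)
  have R: "?R \<in> orth_compl (model_space u)"
    using assms mult_z_minus_constant_in_H2_0_bar
    by (intro V_in_orth_compl H2_add H2_scaleC mult_z_in_H2 one_in_H2) (simp_all add: Q_op_eq)
  have "?k + ?a *\<^sub>C cnj (u 0) *\<^sub>C M one_L2 = ?a *\<^sub>C one_L2"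
    by (simp add: scaleC_add_right[symmetric])
  then have "?a *\<^sub>C cnj (u 0) *\<^sub>C M one_L2 = ?a *\<^sub>C one_L2 - ?k"
    by (simp add: algebra_simps)
  then have eq: "mult_z (V (h, g)) - ?k = ?R"
    by (simp add: V_def mult_z_add mult_L2_add mult_L2_scaleC mult_L2_mult_z Q_op_eq[OF assms(2)]
        scaleC_scaleC mult.commute)
  have "orth_proj (model_space u) (mult_z (V (h, g))) = ?k"
    by (rule orth_proj_eqI[OF model_space_diff k]) (simp_all add: eq R)
  then show ?thesis by (simp add: dual_compressed_shift_def eq)
qed

lemma unitarily_equivalent_block_op:
  "unitarily_equivalent (orth_compl (model_space u)) (dual_compressed_shift u)
     (H2 \<times> H2_0_bar)
     (block_op shift (\<lambda>g. cnj (u 0) *\<^sub>C rank_one one_L2 zbar_L2 g) (\<lambda>_. 0) Q_op)"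
    (is "unitarily_equivalent ?K ?D ?H ?B")
proof (rule unitarily_equivalent_sym)
  have B: "?B (h, g) = (mult_z h + cnj (u 0) *\<^sub>C cinner g zbar_L2 *\<^sub>C one_L2, Q_op g)" for h g
    by (simp add: block_op_def shift_def rank_one_def)
  have B_in: "?B p \<in> ?H" if "p \<in> ?H" for p
    using that mult_z_minus_constant_in_H2_0_bar
    by (cases p) (auto simp: B Q_op_eq intro!: H2_add H2_scaleC mult_z_in_H2 one_in_H2)
  have DV: "?D (V p) = V (?B p)" if "p \<in> ?H" for p
    using that dual_compressed_shift_V by (cases p) (auto simp: B)
  \<comment> \<open>Since \<open>V\<close> preserves inner products, \<open>V p = V q\<close> forces
    \<open>p - q\<close> to have norm 0.\<close>
  have "inj_on V ?H"
  proof (rule inj_onI)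
    fix p q assume pq: "p \<in> ?H" "q \<in> ?H" "V p = V q"
    obtain h g h' g' where p: "p = (h, g)" "q = (h', g')" by (cases p, cases q) auto
    have "V (h - h', g - g') = V p - V q"
      using mult_L2_add[of \<phi> "h - h'" h'] by (simp add: V_def p algebra_simps)
    then have "V (h - h', g - g') = 0" using pq by simp
    then have "cinner (h - h') (h - h') + cinner (g - g') (g - g') = 0"
      using cinner_V[of "h - h'" "g - g'" "h - h'" "g - g'"] pq p
      by (auto simp: H2_diff H2_0_bar_diff)
    then have "cinner (h - h', g - g') (h - h', g - g') = 0"
      by (simp add: cinner_prod_def)
    then show "p = q" by (simp only: cinner_eq_zero_iff) (simp add: p zero_prod_def)
  qed
  then have "bij_betw V ?H ?K"
    by (simp add: bij_betw_def orth_compl_model_space_eq)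
  then have "unitary_between ?H ?K V"
    unfolding unitary_between_def
    by (auto simp: cinner_prod_def cinner_V scaleC_prod_def)
      (simp_all add: V_def mult_L2_add mult_L2_scaleC scaleC_add_right algebra_simps)
  then show "unitarily_equivalent ?H ?B ?K ?D"
    unfolding unitarily_equivalent_def
  proof (intro conjI exI[of _ V] ballI)
    show "?B ` ?H \<subseteq> ?H" using B_in by (rule image_subsetI)
    show "?D ` ?K \<subseteq> ?K"
    proof (rule image_subsetI)
      fix f assume "f \<in> ?K"
      then obtain p where p: "p \<in> ?H" "f = V p"
        unfolding orth_compl_model_space_eq by (rule imageE)
      \<comment> \<open>Invariance of the complement is transported from that of \<open>?H\<close>
        through the intertwining relation \<open>DV\<close>.\<close>
      show "?D f \<in> ?K"
        unfolding p(2) DV[OF p(1)] orth_compl_model_space_eq by (rule imageI) (rule B_in[OF p(1)])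
    qed
    show "V (?B p) = ?D (V p)" if "p \<in> ?H" for p using DV[OF that] by simp
  qed
qed (auto simp: H2_add H2_0_bar_add H2_scaleC H2_0_bar_scaleC scaleC_prod_def)

end

lemma dual_compressed_shift_unitarily_equivalent:
  assumes "inner_function u"
  shows "unitarily_equivalent (orth_compl (model_space u)) (dual_compressed_shift u)
     (H2 \<times> H2_0_bar)
     (block_op shift (\<lambda>g. cnj (u 0) *\<^sub>C rank_one one_L2 zbar_L2 g) (\<lambda>_. 0) Q_op)"
proof -
  obtain \<phi> where "boundary_symbol u \<phi>"
    using inner_function_boundary[OF assms] unfolding boundary_symbol_def by metis
  then show ?thesis by (rule boundary_symbol.unitarily_equivalent_block_op)
qed

theorem theorem4p3:
  fixes u :: "complex \<Rightarrow> complex"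
  assumes "inner_function u"
  shows
    "(u 0 = 0 \<longrightarrow>
        unitarily_equivalent
          (orth_compl (model_space u)) (dual_compressed_shift u)
          (H2 \<times> H2_0_bar) (block_op shift (\<lambda>_. 0) (\<lambda>_. 0) Q_op)) \<and>
     (\<forall>v w. inner_function v \<and> inner_function w \<and> v 0 = 0 \<and> w 0 = 0 \<longrightarrow>
        unitarily_equivalent
          (orth_compl (model_space v)) (dual_compressed_shift v)
          (orth_compl (model_space w)) (dual_compressed_shift w)) \<and>
     (u 0 \<noteq> 0 \<longrightarrow>
        unitarily_equivalent
          (orth_compl (model_space u)) (dual_compressed_shift u)
          (H2 \<times> H2_0_bar)
          (block_op shift (\<lambda>g. cnj (u 0) *\<^sub>C rank_one one_L2 zbar_L2 g) (\<lambda>_. 0) Q_op))"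
proof (intro conjI impI allI)
  \<comment> \<open>The scalar \<open>cnj (v 0)\<close> is 0 here, which removes the off-diagonal
    entry.\<close>
  have zero: "unitarily_equivalent (orth_compl (model_space v)) (dual_compressed_shift v)
      (H2 \<times> H2_0_bar) (block_op shift (\<lambda>_. 0) (\<lambda>_. 0) Q_op)"
    if "inner_function v" "v 0 = 0" for v
    using dual_compressed_shift_unitarily_equivalent[OF that(1)] that(2) by simp
  show "unitarily_equivalent (orth_compl (model_space u)) (dual_compressed_shift u)
      (H2 \<times> H2_0_bar) (block_op shift (\<lambda>_. 0) (\<lambda>_. 0) Q_op)" if "u 0 = 0"
    using zero assms that by blast
  fix v w assume vw: "inner_function v \<and> inner_function w \<and> v 0 = 0 \<and> w 0 = 0"
  show "unitarily_equivalent (orth_compl (model_space v)) (dual_compressed_shift v)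
      (orth_compl (model_space w)) (dual_compressed_shift w)"
    \<comment> \<open>Both operators are equivalent to the same diagonal operator matrix, which
      contains no trace of \<open>v\<close> or \<open>w\<close>.\<close>
    using vw by (intro unitarily_equivalent_trans[OF zero unitarily_equivalent_sym[OF zero]])
      (auto intro: orth_compl_add orth_compl_scaleC)
qed (rule dual_compressed_shift_unitarily_equivalent[OF assms])

end
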